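(* (1) Let $L$ be a modular semilattice. Then $P(L)$ (the set $L^{\mathrm{ir}}$ of $\vee$-irreducible elements of $L$ with the partial order induced from $L$ and with the induced inconsistency and collinearity relations) is a PPIP, and $L$ is isomorphic to $\mathcal{C}(P(L))$. An isomorphism $\phi\colon L\to\mathcal{C}(P(L))$ is given by $\phi(l)=\{p\in L^{\mathrm{ir}}\mid p\le l\}$, and its inverse is $\psi(I)=\bigvee_{x\in I}x$ for nonempty $I$, with $\psi(\emptyset)=\min L$. (2) Let $P$ be a PPIP. Then $\mathcal{C}(P)$, ordered by inclusion, is a modular semilattice, and $P(\mathcal{C}(P))$ is isomorphic to $P$. Here an isomorphism is a bijection that preserves and reflects the partial order, the inconsistency relation and the collinearity relation.
   Context: All posets and semilattices have finite rank (finite length). Semilattices are meet-semilattices. In a semilattice the join $x\vee y$ is the least common upper bound, and it may fail to exist. An element $l$ is $\vee$-irreducible if $l$ is not the minimum and $l=a\vee b$ implies $l=a$ or $l=b$. A semilattice $L$ is modular if both of the following hold: every principal ideal $\{y\mid y\le x\}$ is a modular lattice; and $x\vee y\vee z$ exists whenever $x\vee y$, $y\vee z$ and $z\vee x$ all exist. Induced relations on $L^{\mathrm{ir}}$. Set $x\smile y$ iff $x\vee y$ does not exist. Set $C(x,y,z)$ iff $x,y,z$ are pairwise incomparable, $x\vee y$, $y\vee z$, $z\vee x$ all exist, and $x\vee y=y\vee z=z\vee x$. Let $P$ be a poset. - An inconsistency relation on $P$ is a symmetric binary relation $\smile$ satisfying: - (IC1) if $p\smile q$, then $p,q$ have no common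 upper bound; - (IC2) if $p\smile q$, $p\le p'$ and $q\le q'$, then $p'\smile q'$. - A subset of $P$ is consistent if it contains no $p,q$ with $p\smile q$. - A collinearity relation is a ternary relation $C$ invariant under permutations of its arguments, satisfying: - (CT1) if $C(p,q,r)$, then $p,q,r$ are pairwise incomparable; - (CT2) if $C(p,q,r)$, $p\le w$ and $q\le w$, then $r\le w$. A poset $P$ with an inconsistency relation $\smile$ and a collinearity relation $C$ is a PPIP if the following three axioms hold. - Regularity: if $C(p,q,r)$ and $r'\le r$ with $r'\not\le p$ and $r'\not\le q$, then there exist $p'\le p$ and $q'\le q$ with $C(p',q',r')$. - Weak Triangle: if $C(a,c,p)$ and $C(b,c,q)$ hold and $\{a,b,c,p,q\}$ is consistent, then at least one of the following holds: - (i) there is $x$ such that $C(a,b,x)$ and $C(p,q,x)$ hold, $\{a,b,c,p,q,x\}$ is pairwise incomparable, and the only collinear triples within $\{a,b,c,p,q,x\}$ are $(a,c,p)$, $(b,c,q)$, $(a,b,x)$, $(p,q,x)$ and their permutations; - (ii) there is $a'\le a$ with $C(b,q,a')$; - (iii) $C(b,q,p)$; - (iv) there are $a'\le a$ and $p'\le p$ with $C(q,a',p')$; - (v) $q\le a$ or $q\le p$. - Consistent-Collinearity: for every $p,q,r$ with $C(p,q,r)$: - (CC1) $\{p,q,r\}$ is consistent; - (CC2) every $x\in P$ is consistent with at most one of $p,q,r$, or with all of them. An ideal $X\subseteq P$ is a subspace if $p,q\in X$ and $C(p,q,r)$ imply $r\in X$. $\mathcal{C}(P)$ denotes the family of consistent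 subspaces of $P$, ordered by inclusion. *)

theory Defs
  imports "HOL-Algebra.Lattice"
begin

definition is_chain :: "('a, 'm) gorder_scheme \<Rightarrow> 'a set \<Rightarrow> bool" where
  "is_chain L K \<longleftrightarrow> K \<subseteq> carrier L \<and> (\<forall>x\<in>K. \<forall>y\<in>K. x \<sqsubseteq>\<^bsub>L\<^esub> y \<or> y \<sqsubseteq>\<^bsub>L\<^esub> x)"

text \<open>Finite rank: the lengths of chains are bounded (not merely finite).
  This is kept apart from the algebraic notions below and is assumed explicitly where needed.\<close>

definition finite_length :: "('a, 'm) gorder_scheme \<Rightarrow> bool" where
  "finite_length L \<longleftrightarrow> (\<exists>n. \<forall>K. is_chain L K \<longrightarrow> finite K \<and> card K \<le> n)"

definition incomparable :: "('a, 'm) gorder_scheme \<Rightarrow> 'a \<Rightarrow> 'a \<Rightarrow> bool" where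
  "incomparable L x y \<longleftrightarrow> \<not> x \<sqsubseteq>\<^bsub>L\<^esub> y \<and> \<not> y \<sqsubseteq>\<^bsub>L\<^esub> x"

definition order_iso :: "('a, 'm) gorder_scheme \<Rightarrow> ('b, 'n) gorder_scheme \<Rightarrow> ('a \<Rightarrow> 'b) \<Rightarrow> bool" where
  "order_iso L M f \<longleftrightarrow> order_emb L M f \<and> bij_betw f (carrier L) (carrier M)"


section \<open>Modular semilattices\<close>

text \<open>The library operations \<open>\<Squnion>\<^bsub>L\<^esub>\<close> and \<open>\<squnion>\<^bsub>L\<^esub>\<close> are total (defined by choice), so the existence of
  a join is a separate condition.\<close>

definition has_join :: "('a, 'm) gorder_scheme \<Rightarrow> 'a set \<Rightarrow> bool" where
  "has_join L A \<longleftrightarrow> (\<exists>s. least L s (Upper L A))"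

definition principal_ideal :: "('a, 'm) gorder_scheme \<Rightarrow> 'a \<Rightarrow> ('a, 'm) gorder_scheme" where
  "principal_ideal L x = L\<lparr>carrier := {y \<in> carrier L. y \<sqsubseteq>\<^bsub>L\<^esub> x}\<rparr>"

locale modular_lattice = lattice +
  assumes modular_law:
    "\<lbrakk>x \<in> carrier L; y \<in> carrier L; z \<in> carrier L; x \<sqsubseteq> z\<rbrakk> \<Longrightarrow> x \<squnion> (y \<sqinter> z) = (x \<squnion> y) \<sqinter> z"

locale modular_semilattice = lower_semilattice +
  assumes nonempty: "carrier L \<noteq> {}"
    and principal_ideal_modular: "x \<in> carrier L \<Longrightarrow> modular_lattice (principal_ideal L x)"
    and triple_join:
      "\<lbrakk>x \<in> carrier L; y \<in> carrier L; z \<in> carrier L;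
        has_join L {x, y}; has_join L {y, z}; has_join L {z, x}\<rbrakk> \<Longrightarrow> has_join L {x, y, z}"

definition join_irreducibles :: "('a, 'm) gorder_scheme \<Rightarrow> 'a set" where
  "join_irreducibles L = {l \<in> carrier L. \<not> least L l (carrier L) \<and>
     (\<forall>a\<in>carrier L. \<forall>b\<in>carrier L. least L l (Upper L {a, b}) \<longrightarrow> l = a \<or> l = b)}"


section \<open>Posets with inconsistency and collinearity relations\<close>

record 'a pip = "'a gorder" +
  incon :: "'a \<Rightarrow> 'a \<Rightarrow> bool" (infixl \<open>\<smile>\<index>\<close> 50)
  collinear :: "'a \<Rightarrow> 'a \<Rightarrow> 'a \<Rightarrow> bool" (\<open>col\<index>\<close>)

locale inconsistency_relation = partial_order P for P :: "('a, 'm) pip_scheme" (structure) +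
  assumes incon_sym: "\<lbrakk>p \<in> carrier P; q \<in> carrier P; p \<smile> q\<rbrakk> \<Longrightarrow> q \<smile> p"
    and IC1: "\<lbrakk>p \<in> carrier P; q \<in> carrier P; p \<smile> q\<rbrakk> \<Longrightarrow> \<not> (\<exists>u\<in>carrier P. p \<sqsubseteq> u \<and> q \<sqsubseteq> u)"
    and IC2: "\<lbrakk>p \<in> carrier P; q \<in> carrier P; p' \<in> carrier P; q' \<in> carrier P;
        p \<smile> q; p \<sqsubseteq> p'; q \<sqsubseteq> q'\<rbrakk> \<Longrightarrow> p' \<smile> q'"

locale collinearity_relation = partial_order P for P :: "('a, 'm) pip_scheme" (structure) +
  assumes col_perm: "\<lbrakk>p \<in> carrier P; q \<in> carrier P; r \<in> carrier P; col p q r\<rbrakk> \<Longrightarrow> col q p r \<and> col q r p"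
    and CT1: "\<lbrakk>p \<in> carrier P; q \<in> carrier P; r \<in> carrier P; col p q r\<rbrakk>
        \<Longrightarrow> incomparable P p q \<and> incomparable P q r \<and> incomparable P p r"
    and CT2: "\<lbrakk>p \<in> carrier P; q \<in> carrier P; r \<in> carrier P; w \<in> carrier P;
        col p q r; p \<sqsubseteq> w; q \<sqsubseteq> w\<rbrakk> \<Longrightarrow> r \<sqsubseteq> w"

definition consistent :: "('a, 'm) pip_scheme \<Rightarrow> 'a set \<Rightarrow> bool" where
  "consistent P X \<longleftrightarrow> \<not> (\<exists>p\<in>X. \<exists>q\<in>X. p \<smile>\<^bsub>P\<^esub> q)"

text \<open>The first alternative of the Weak Triangle axiom: \<open>a, b, c, p, q, x\<close> are six different points.
  Collinear triples consist of distinct points and are closed under permutation, so a triple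
  is determined up to permutation by its underlying set.\<close>

definition triangle_configuration ::
    "('a, 'm) pip_scheme \<Rightarrow> 'a \<Rightarrow> 'a \<Rightarrow> 'a \<Rightarrow> 'a \<Rightarrow> 'a \<Rightarrow> 'a \<Rightarrow> bool" where
  "triangle_configuration P a b c p q x \<longleftrightarrow>
     col\<^bsub>P\<^esub> a b x \<and> col\<^bsub>P\<^esub> p q x \<and>
     distinct [a, b, c, p, q, x] \<and>
     (\<forall>u\<in>{a, b, c, p, q, x}. \<forall>v\<in>{a, b, c, p, q, x}. u \<noteq> v \<longrightarrow> incomparable P u v) \<and>
     (\<forall>u\<in>{a, b, c, p, q, x}. \<forall>v\<in>{a, b, c, p, q, x}. \<forall>w\<in>{a, b, c, p, q, x}.
        col\<^bsub>P\<^esub> u v w \<longrightarrow> {u, v, w} \<in> {{a, c, p}, {b, c, q}, {a, b, x}, {p, q, x}})"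

locale PPIP = inconsistency_relation P + collinearity_relation P
  for P :: "('a, 'm) pip_scheme" (structure) +
  assumes regularity:
      "\<lbrakk>p \<in> carrier P; q \<in> carrier P; r \<in> carrier P; r' \<in> carrier P;
        col p q r; r' \<sqsubseteq> r; \<not> r' \<sqsubseteq> p; \<not> r' \<sqsubseteq> q\<rbrakk>
        \<Longrightarrow> \<exists>p'\<in>carrier P. \<exists>q'\<in>carrier P. p' \<sqsubseteq> p \<and> q' \<sqsubseteq> q \<and> col p' q' r'"
    and weak_triangle:
      "\<lbrakk>a \<in> carrier P; b \<in> carrier P; c \<in> carrier P; p \<in> carrier P; q \<in> carrier P;
        col a c p; col b c q; consistent P {a, b, c, p, q}\<rbrakk>
        \<Longrightarrow> (\<exists>x\<in>carrier P. triangle_configuration P a b c p q x)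
          \<or> (\<exists>a'\<in>carrier P. a' \<sqsubseteq> a \<and> col b q a')
          \<or> col b q p
          \<or> (\<exists>a'\<in>carrier P. \<exists>p'\<in>carrier P. a' \<sqsubseteq> a \<and> p' \<sqsubseteq> p \<and> col q a' p')
          \<or> q \<sqsubseteq> a \<or> q \<sqsubseteq> p"
    and CC1:
      "\<lbrakk>p \<in> carrier P; q \<in> carrier P; r \<in> carrier P; col p q r\<rbrakk> \<Longrightarrow> consistent P {p, q, r}"
    and CC2:
      "\<lbrakk>p \<in> carrier P; q \<in> carrier P; r \<in> carrier P; x \<in> carrier P; col p q r\<rbrakk>
        \<Longrightarrow> card {s \<in> {p, q, r}. \<not> x \<smile> s} \<le> 1 \<or> (\<forall>s\<in>{p, q, r}. \<not> x \<smile> s)"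

definition pip_iso :: "('a, 'm) pip_scheme \<Rightarrow> ('b, 'n) pip_scheme \<Rightarrow> ('a \<Rightarrow> 'b) \<Rightarrow> bool" where
  "pip_iso P Q f \<longleftrightarrow> order_iso P Q f \<and>
     (\<forall>p\<in>carrier P. \<forall>q\<in>carrier P. p \<smile>\<^bsub>P\<^esub> q \<longleftrightarrow> f p \<smile>\<^bsub>Q\<^esub> f q) \<and>
     (\<forall>p\<in>carrier P. \<forall>q\<in>carrier P. \<forall>r\<in>carrier P. col\<^bsub>P\<^esub> p q r \<longleftrightarrow> col\<^bsub>Q\<^esub> (f p) (f q) (f r))"

definition subspace :: "('a, 'm) pip_scheme \<Rightarrow> 'a set \<Rightarrow> bool" where
  "subspace P X \<longleftrightarrow> X \<subseteq> carrier P \<and>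
     (\<forall>x\<in>X. \<forall>y\<in>carrier P. y \<sqsubseteq>\<^bsub>P\<^esub> x \<longrightarrow> y \<in> X) \<and>
     (\<forall>p\<in>X. \<forall>q\<in>X. \<forall>r\<in>carrier P. col\<^bsub>P\<^esub> p q r \<longrightarrow> r \<in> X)"

definition consistent_subspaces :: "('a, 'm) pip_scheme \<Rightarrow> 'a set gorder" where
  "consistent_subspaces P =
     \<lparr>carrier = {X. subspace P X \<and> consistent P X}, eq = (=), le = (\<subseteq>)\<rparr>"


section \<open>The two constructions\<close>

definition irreducible_pip :: "('a, 'm) gorder_scheme \<Rightarrow> 'a pip" where
  "irreducible_pip L =
     \<lparr>carrier = join_irreducibles L, eq = (=), le = le L,
      incon = (\<lambda>x y. \<not> has_join L {x, y}),
      collinear = (\<lambda>x y z.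
        incomparable L x y \<and> incomparable L y z \<and> incomparable L x z \<and>
        has_join L {x, y} \<and> has_join L {y, z} \<and> has_join L {z, x} \<and>
        x \<squnion>\<^bsub>L\<^esub> y = y \<squnion>\<^bsub>L\<^esub> z \<and> y \<squnion>\<^bsub>L\<^esub> z = z \<squnion>\<^bsub>L\<^esub> x)\<rparr>"

definition phi :: "('a, 'm) gorder_scheme \<Rightarrow> 'a \<Rightarrow> 'a set" where
  "phi L l = {p \<in> join_irreducibles L. p \<sqsubseteq>\<^bsub>L\<^esub> l}"

definition psi :: "('a, 'm) gorder_scheme \<Rightarrow> 'a set \<Rightarrow> 'a" where
  "psi L I = (if I = {} then \<bottom>\<^bsub>L\<^esub> else \<Squnion>\<^bsub>L\<^esub>I)"

end

theory Submission
  imports Defs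
begin

text \<open>Part (1).  In a modular lattice, if \<open>p\<close> is join-irreducible and not below \<open>e\<close>, then \<open>e \<squnion> p\<close> is
  join-irreducible in the interval above \<open>e\<close>.  Minimal choices then show that \<open>p \<sqsubseteq> x \<squnion> y\<close> forces
  \<open>p \<sqsubseteq> x\<close>, \<open>p \<sqsubseteq> y\<close> or a collinear triple \<open>x', y', p\<close> with \<open>x' \<sqsubseteq> x\<close> and \<open>y' \<sqsubseteq> y\<close>.  This gives
  Regularity, and shows that a consistent subspace is the set of all irreducibles below its join.
  For the Weak Triangle axiom, when the other alternatives fail, the sixth point is an irreducible
  \<open>x\<close> below \<open>(a \<squnion> b) \<sqinter> (p \<squnion> q)\<close> with \<open>a \<squnion> x = a \<squnion> b\<close>; irreducibility of \<open>a\<close>, \<open>q\<close>, \<open>p\<close> gives in turn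
  \<open>b \<squnion> x = a \<squnion> b\<close>, \<open>p \<squnion> x = p \<squnion> q\<close> and \<open>q \<squnion> x = p \<squnion> q\<close>.

  Part (2).  For ideals let \<open>X + Y\<close> consist of \<open>X\<close>, \<open>Y\<close> and all points collinear with a point of
  \<open>X\<close> and a point of \<open>Y\<close>.  The Weak Triangle axiom makes this sum associative, so that it is the join
  of subspaces, and the modular law is then immediate.  The principal ideals are irreducible
  subspaces.  Conversely, the heights of the points of a subspace are bounded, and a point \<open>p\<close> of
  maximal height has a proper subspace \<open>Y\<close> with \<open>Y + \<down>p\<close> equal to the whole; so an irreducible
  subspace is principal.\<close>


section \<open>Chain conditions\<close>

text \<open>An infinite descending sequence for \<open>r\<close> is injective and its range is a
  chain, which finite length forbids. Keeping \<open>r\<close> abstract lets the strict order and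
  its converse both be instances, so one argument yields minimal and maximal elements.\<close>

lemma finite_length_wf:
  assumes L: "finite_length L"
    and r: "trans r" "irrefl r" "r \<subseteq> carrier L \<times> carrier L"
    and comparable: "\<And>x y. (x, y) \<in> r \<Longrightarrow> x \<sqsubseteq>\<^bsub>L\<^esub> y \<or> y \<sqsubseteq>\<^bsub>L\<^esub> x"
    and refl: "\<And>x. x \<in> carrier L \<Longrightarrow> x \<sqsubseteq>\<^bsub>L\<^esub> x"
  shows "wf r"
proof (rule ccontr)
  assume "\<not> wf r"
  then obtain f where f: "\<And>i. (f (Suc i), f i) \<in> r"
    by (auto simp: wf_iff_no_infinite_down_chain)
  have less: "(f j, f i) \<in> r" if "i < j" for i j
    using that
  proof (induction j)
    case (Suc j)
    then show ?case using f[of j] \<open>trans r\<close> by (metis less_Suc_eq transD)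
  qed simp
  have "inj f"
    using less \<open>irrefl r\<close> by (metis injI irreflD linorder_neqE_nat)
  moreover have "is_chain L (range f)"
    unfolding is_chain_def
  proof (intro conjI ballI)
    show "range f \<subseteq> carrier L" using f r(3) by blast
    fix x y assume "x \<in> range f" "y \<in> range f"
    then obtain i j where "x = f i" "y = f j" by blast
    then show "x \<sqsubseteq>\<^bsub>L\<^esub> y \<or> y \<sqsubseteq>\<^bsub>L\<^esub> x"
      using less[of i j] less[of j i] comparable refl \<open>range f \<subseteq> carrier L\<close>
      by (metis linorder_neqE_nat rangeI subsetD)
  qed
  ultimately show False
    using L finite_imageD[of f UNIV] by (auto simp: finite_length_def)
qed

lemma (in partial_order) minimal_element:
  assumes "finite_length L" "S \<subseteq> carrier L" "x \<in> S"
  obtains m where "m \<in> S" "\<And>y. y \<in> S \<Longrightarrow> y \<sqsubseteq> m \<Longrightarrow> y = m"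
proof -
  let ?r = "{(x, y). x \<in> carrier L \<and> y \<in> carrier L \<and> x \<sqsubseteq> y \<and> x \<noteq> y}"
  have "wf ?r"
    by (rule finite_length_wf[OF assms(1)])
      (auto simp: irrefl_def intro!: transI intro: le_trans)
  from wfE_min[OF this assms(3)] obtain m where
    "m \<in> S" "\<And>y. (y, m) \<in> ?r \<Longrightarrow> y \<notin> S" by blast
  then show thesis using assms(2) that by blast
qed

lemma (in partial_order) maximal_element:
  assumes "finite_length L" "S \<subseteq> carrier L" "x \<in> S"
  obtains m where "m \<in> S" "\<And>y. y \<in> S \<Longrightarrow> m \<sqsubseteq> y \<Longrightarrow> y = m"
proof -
  let ?r = "{(x, y). x \<in> carrier L \<and> y \<in> carrier L \<and> y \<sqsubseteq> x \<and> x \<noteq> y}"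
  have "wf ?r"
    by (rule finite_length_wf[OF assms(1)])
      (auto simp: irrefl_def intro!: transI intro: le_trans)
  from wfE_min[OF this assms(3)] obtain m where
    "m \<in> S" "\<And>y. (y, m) \<in> ?r \<Longrightarrow> y \<notin> S" by blast
  then show thesis using assms(2) that by blast
qed

lemma finite_length_mono:
  assumes "finite_length L" "carrier M \<subseteq> carrier L" "le M = le L"
  shows "finite_length M"
proof -
  obtain n where n: "\<And>K. is_chain L K \<Longrightarrow> finite K \<and> card K \<le> n"
    using assms(1) by (auto simp: finite_length_def)
  have "is_chain L K" if "is_chain M K" for K
    using that assms(2,3) by (auto simp: is_chain_def)
  then show ?thesis unfolding finite_length_def using n by blast
qed


section \<open>Join-irreducible elements of modular lattices of finite length\<close>

lemma join_irreducibles_closed: "p \<in> join_irreducibles L \<Longrightarrow> p \<in> carrier L"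
  by (simp add: join_irreducibles_def)

lemma carrier_irreducible_pip [simp]: "carrier (irreducible_pip L) = join_irreducibles L"
  and le_irreducible_pip [simp]: "le (irreducible_pip L) = le L"
  and incon_irreducible_pip [simp]: "x \<smile>\<^bsub>irreducible_pip L\<^esub> y \<longleftrightarrow> \<not> has_join L {x, y}"
  and incomparable_irreducible_pip [simp]:
    "incomparable (irreducible_pip L) x y \<longleftrightarrow> incomparable L x y"
  by (simp_all add: irreducible_pip_def incomparable_def)

locale finite_length_modular_lattice = modular_lattice +
  assumes finite_length: "finite_length L"
begin

abbreviation J :: "'a set" where "J \<equiv> join_irreducibles L"

lemma J_closed [simp, intro]: "p \<in> J \<Longrightarrow> p \<in> carrier L"
  by (rule join_irreducibles_closed)

lemma join_le_iff [simp]: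
  assumes "x \<in> carrier L" "y \<in> carrier L" "z \<in> carrier L"
  shows "x \<squnion> y \<sqsubseteq> z \<longleftrightarrow> x \<sqsubseteq> z \<and> y \<sqsubseteq> z"
  using assms le_trans[OF join_left[of x y], of z] le_trans[OF join_right[of x y], of z]
  by (auto intro: join_le)

lemma le_meet_iff [simp]:
  assumes "x \<in> carrier L" "y \<in> carrier L" "z \<in> carrier L"
  shows "z \<sqsubseteq> x \<sqinter> y \<longleftrightarrow> z \<sqsubseteq> x \<and> z \<sqsubseteq> y"
  using assms le_trans[OF _ meet_left[of x y], of z] le_trans[OF _ meet_right[of x y], of z]
  by (auto intro: meet_le)

lemma le_joinI1:
  assumes "z \<sqsubseteq> x" "x \<in> carrier L" "y \<in> carrier L" "z \<in> carrier L"
  shows "z \<sqsubseteq> x \<squnion> y"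
  using assms le_trans[OF _ join_left[of x y], of z] by simp

lemma le_joinI2:
  assumes "z \<sqsubseteq> y" "x \<in> carrier L" "y \<in> carrier L" "z \<in> carrier L"
  shows "z \<sqsubseteq> x \<squnion> y"
  using assms le_trans[OF _ join_right[of x y], of z] by simp

lemma least_join: "\<lbrakk>x \<in> carrier L; y \<in> carrier L\<rbrakk> \<Longrightarrow> least L (x \<squnion> y) (Upper L {x, y})"
  unfolding join_def by (rule sup_of_two_least)

lemma has_join [simp]: "\<lbrakk>x \<in> carrier L; y \<in> carrier L\<rbrakk> \<Longrightarrow> has_join L {x, y}"
  using least_join by (auto simp: has_join_def)

section \<open>Irreducible elements in intervals above a fixed element\<close>

lemma irreducibleI:
  assumes "p \<in> carrier L" "e \<in> carrier L" "\<not> p \<sqsubseteq> e"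
    and "\<And>a b. \<lbrakk>a \<in> carrier L; b \<in> carrier L; p = a \<squnion> b\<rbrakk> \<Longrightarrow> p = a \<or> p = b"
  shows "p \<in> J"
  unfolding join_irreducibles_def
proof (intro CollectI conjI ballI impI)
  show "\<not> least L p (carrier L)" using assms(2,3) by (auto simp: least_def)
  fix a b assume ab: "a \<in> carrier L" "b \<in> carrier L" "least L p (Upper L {a, b})"
  then have "p = a \<squnion> b"
    using least_join weak_least_unique by (auto simp: eq_is_equal)
  then show "p = a \<or> p = b" using assms(4) ab by blast
qed (rule assms(1))

lemma irreducibleD:
  assumes "p \<in> J" "a \<in> carrier L" "b \<in> carrier L" "p = a \<squnion> b"
  shows "p = a \<or> p = b"
proof -
  have "least L p (Upper L {a, b})" using least_join[of a b] assms by metis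
  then show ?thesis using assms(1-3) unfolding join_irreducibles_def mem_Collect_eq by metis
qed

text \<open>Irreducibility of \<open>p\<close> survives in the interval from \<open>e\<close> to
  \<open>e \<squnion> p\<close>. The elements \<open>s\<close> and \<open>t\<close> are pulled back
  to elements below \<open>p\<close>, where irreducibility of \<open>p\<close> itself
  applies.\<close>

lemma irreducible_le_over:
  assumes p: "p \<in> J" and C: "e \<in> carrier L" "s \<in> carrier L" "t \<in> carrier L"
    and s: "s \<sqsubseteq> e \<squnion> p" and t: "t \<sqsubseteq> e \<squnion> p" and le: "p \<sqsubseteq> e \<squnion> (s \<squnion> t)"
  shows "p \<sqsubseteq> e \<squnion> s \<or> p \<sqsubseteq> e \<squnion> t"
proof -
  have pC: "p \<in> carrier L" using p by blast
  note C = C pC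
  let ?s = "p \<sqinter> (e \<squnion> s)" and ?t = "p \<sqinter> (e \<squnion> t)"
  let ?d = "?s \<squnion> ?t"
  \<comment> \<open>By modularity the pullback \<open>p \<sqinter> (e \<squnion> x)\<close> recovers
    all of \<open>x\<close> once it is joined with \<open>e\<close>.\<close>
  have proj: "x \<sqsubseteq> e \<squnion> (p \<sqinter> (e \<squnion> x))" if "x \<in> carrier L" "x \<sqsubseteq> e \<squnion> p" for x
  proof -
    have "e \<squnion> (p \<sqinter> (e \<squnion> x)) = (e \<squnion> p) \<sqinter> (e \<squnion> x)"
      by (rule modular_law) (use C that in \<open>auto intro: join_left\<close>)
    then show ?thesis using C that by (simp add: join_right)
  qed
  have "e \<squnion> ?s \<sqsubseteq> e \<squnion> ?d" "e \<squnion> ?t \<sqsubseteq> e \<squnion> ?d"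
    using C by (simp_all add: join_left join_right le_joinI2)
  then have "s \<sqsubseteq> e \<squnion> ?d" "t \<sqsubseteq> e \<squnion> ?d"
    using le_trans[OF proj[OF _ s]] le_trans[OF proj[OF _ t]] C by simp_all
  then have "p \<sqsubseteq> e \<squnion> ?d"
    using le_trans[OF le] C by (simp add: join_left)
  moreover have "?d \<sqsubseteq> p" using C by (simp add: meet_left)
  \<comment> \<open>Since \<open>?d \<sqsubseteq> p\<close>, modularity exhibits \<open>p\<close> as
    the join of \<open>?s\<close>, \<open>?t\<close> and \<open>e \<sqinter> p\<close>;
    irreducibility, used twice, selects one of the three.\<close>
  moreover from this have "?d \<squnion> (e \<sqinter> p) = (?d \<squnion> e) \<sqinter> p"
    by (intro modular_law) (use C in auto)
  ultimately have "p = ?d \<squnion> (e \<sqinter> p)"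
    using C by (intro le_antisym) (auto simp: join_comm[of L ?d e] meet_right)
  then have "p = ?d \<or> p = e \<sqinter> p" using irreducibleD p C by (metis join_closed meet_closed)
  then have "p = ?s \<or> p = ?t \<or> p = e \<sqinter> p" using irreducibleD p C by (metis join_closed meet_closed)
  then show ?thesis
    using C by (metis join_closed le_joinI1 meet_left meet_right)
qed

text \<open>The modular law makes \<open>p\<close> the join of \<open>p'\<close> and
  \<open>e \<sqinter> p\<close>, and the second is not \<open>p\<close>. Later this promotes a point
  found below \<open>p\<close> to \<open>p\<close> itself.\<close>

lemma irreducible_shrink:
  assumes "p \<in> J" "e \<in> carrier L" "p' \<in> carrier L" "\<not> p \<sqsubseteq> e" "p' \<sqsubseteq> p" "p \<sqsubseteq> e \<squnion> p'"
  shows "p' = p"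
proof -
  have "p' \<squnion> (e \<sqinter> p) = (p' \<squnion> e) \<sqinter> p"
    by (rule modular_law) (use assms in auto)
  also have "\<dots> = p"
    using assms by (intro le_antisym) (auto simp: join_comm[of L p' e] meet_right)
  finally show ?thesis
    using irreducibleD[of p p' "e \<sqinter> p"] assms by (metis J_closed meet_closed meet_left)
qed

text \<open>An element \<open>x\<close> below \<open>w\<close> that is minimal with
  \<open>p \<sqsubseteq> e \<squnion> x\<close> is irreducible: for
  \<open>x = a \<squnion> b\<close>, irreducibility of \<open>p\<close> over \<open>e\<close> passes
  the inequality to \<open>a\<close> or \<open>b\<close>, which then equals \<open>x\<close> by
  minimality.\<close>

lemma irreducible_below_over:
  assumes p: "p \<in> J" and C: "e \<in> carrier L" "w \<in> carrier L"
    and "\<not> p \<sqsubseteq> e" "w \<sqsubseteq> e \<squnion> p" "p \<sqsubseteq> e \<squnion> w"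
  obtains x where "x \<in> J" "x \<sqsubseteq> w" "p \<sqsubseteq> e \<squnion> x"
proof -
  let ?S = "{x \<in> carrier L. x \<sqsubseteq> w \<and> p \<sqsubseteq> e \<squnion> x}"
  obtain x where x: "x \<in> ?S" and min: "\<And>y. y \<in> ?S \<Longrightarrow> y \<sqsubseteq> x \<Longrightarrow> y = x"
    by (rule minimal_element[OF finite_length, of ?S w]) (use assms in auto)
  have "\<not> x \<sqsubseteq> e"
    using x assms by (metis (no_types, lifting) J_closed join_closed join_le le_refl le_trans mem_Collect_eq)
  then have "x \<in> J"
  proof (rule irreducibleI[rotated 2])
    fix a b assume ab: "a \<in> carrier L" "b \<in> carrier L" "x = a \<squnion> b"
    then have le: "a \<sqsubseteq> x" "b \<sqsubseteq> x" by (simp_all add: join_left join_right)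
    then have "a \<sqsubseteq> w" "b \<sqsubseteq> w" using x ab C by (auto intro: le_trans)
    moreover from this have "a \<sqsubseteq> e \<squnion> p" "b \<sqsubseteq> e \<squnion> p"
      using assms ab by (meson J_closed join_closed le_trans)+
    then have "p \<sqsubseteq> e \<squnion> a \<or> p \<sqsubseteq> e \<squnion> b"
      using irreducible_le_over[OF p] C ab x by auto
    ultimately show "x = a \<or> x = b" using min[of a] min[of b] le ab by auto
  qed (use x C in auto)
  with x that show thesis by blast
qed

text \<open>Join-density of the irreducibles: a minimal element below \<open>l\<close> but not below
  \<open>m\<close> is irreducible, because two elements below \<open>m\<close> have their join below
  \<open>m\<close>.\<close>

lemma irreducible_below:
  assumes "l \<in> carrier L" "m \<in> carrier L" "\<not> l \<sqsubseteq> m"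
  obtains p where "p \<in> J" "p \<sqsubseteq> l" "\<not> p \<sqsubseteq> m"
proof -
  let ?S = "{x \<in> carrier L. x \<sqsubseteq> l \<and> \<not> x \<sqsubseteq> m}"
  obtain x where x: "x \<in> ?S" and min: "\<And>y. y \<in> ?S \<Longrightarrow> y \<sqsubseteq> x \<Longrightarrow> y = x"
    by (rule minimal_element[OF finite_length, of ?S l]) (use assms in auto)
  have "x \<in> J"
  proof (rule irreducibleI[of x m])
    fix a b assume ab: "a \<in> carrier L" "b \<in> carrier L" "x = a \<squnion> b"
    then have le: "a \<sqsubseteq> x" "b \<sqsubseteq> x" by (simp_all add: join_left join_right)
    then have "a \<sqsubseteq> l" "b \<sqsubseteq> l" using x ab assms by (auto intro: le_trans)
    moreover have "\<not> a \<sqsubseteq> m \<or> \<not> b \<sqsubseteq> m" using x ab assms by auto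
    ultimately show "x = a \<or> x = b" using min[of a] min[of b] le ab by auto
  qed (use x assms in auto)
  with x that show thesis by blast
qed

section \<open>Collinear triples in a modular lattice\<close>

abbreviation C :: "'a \<Rightarrow> 'a \<Rightarrow> 'a \<Rightarrow> bool" where "C \<equiv> collinear (irreducible_pip L)"

lemma collinear_iff:
  assumes "x \<in> carrier L" "y \<in> carrier L" "z \<in> carrier L"
  shows "C x y z \<longleftrightarrow>
    incomparable L x y \<and> incomparable L y z \<and> incomparable L x z \<and>
    x \<sqsubseteq> y \<squnion> z \<and> y \<sqsubseteq> z \<squnion> x \<and> z \<sqsubseteq> x \<squnion> y"
proof -
  have swap: "u \<squnion> v = v \<squnion> w \<longleftrightarrow> u \<sqsubseteq> v \<squnion> w \<and> w \<sqsubseteq> u \<squnion> v"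
    if "u \<in> carrier L" "v \<in> carrier L" "w \<in> carrier L" for u v w
  proof
    assume eq: "u \<squnion> v = v \<squnion> w"
    show "u \<sqsubseteq> v \<squnion> w \<and> w \<sqsubseteq> u \<squnion> v"
      using join_left[of u v] join_right[of v w] that by (simp add: eq)
  next
    assume "u \<sqsubseteq> v \<squnion> w \<and> w \<sqsubseteq> u \<squnion> v"
    then show "u \<squnion> v = v \<squnion> w"
      using that by (intro le_antisym) (simp_all add: join_left join_right)
  qed
  have "x \<squnion> y = y \<squnion> z \<and> y \<squnion> z = z \<squnion> x \<longleftrightarrow> x \<sqsubseteq> y \<squnion> z \<and> y \<sqsubseteq> z \<squnion> x \<and> z \<sqsubseteq> x \<squnion> y"
    using assms swap[of x y z] swap[of y z x] by (auto simp: join_comm)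
  then show ?thesis using assms by (simp add: irreducible_pip_def)
qed

text \<open>The points are minimal choices: first \<open>x'\<close> relative to \<open>y\<close>,
  then \<open>y'\<close> relative to \<open>x'\<close>. Minimality, together with modularity, forces
  both the collinearity and the irreducibility of the two points.\<close>

lemma irreducible_le_join:
  assumes p: "p \<in> J" and x: "x \<in> carrier L" and y: "y \<in> carrier L" and le: "p \<sqsubseteq> x \<squnion> y"
    and "\<not> p \<sqsubseteq> x" "\<not> p \<sqsubseteq> y"
  obtains x' y' where "x' \<in> J" "y' \<in> J" "x' \<sqsubseteq> x" "y' \<sqsubseteq> y" "C x' y' p"
proof -
  let ?S = "{u \<in> carrier L. u \<sqsubseteq> x \<and> p \<sqsubseteq> u \<squnion> y}"
  obtain x' where x': "x' \<in> ?S" and min_x: "\<And>u. u \<in> ?S \<Longrightarrow> u \<sqsubseteq> x' \<Longrightarrow> u = x'"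
    by (rule minimal_element[OF finite_length, of ?S x]) (use assms in auto)
  let ?T = "{v \<in> carrier L. v \<sqsubseteq> y \<and> p \<sqsubseteq> x' \<squnion> v}"
  obtain y' where y': "y' \<in> ?T" and min_y: "\<And>v. v \<in> ?T \<Longrightarrow> v \<sqsubseteq> y' \<Longrightarrow> v = y'"
    by (rule minimal_element[OF finite_length, of ?T y]) (use assms x' in auto)
  have cl [simp]: "x' \<in> carrier L" "y' \<in> carrier L" "p \<in> carrier L"
    and le': "x' \<sqsubseteq> x" "y' \<sqsubseteq> y" "p \<sqsubseteq> x' \<squnion> y'"
    using x' y' p by auto
  \<comment> \<open>\<open>x'\<close> was chosen minimal relative to \<open>y\<close>; as
    \<open>y' \<sqsubseteq> y\<close>, it is also minimal relative to \<open>y'\<close>.\<close>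
  have min_x': "u = x'" if "u \<in> carrier L" "u \<sqsubseteq> x'" "p \<sqsubseteq> u \<squnion> y'" for u
  proof (rule min_x)
    have "u \<squnion> y' \<sqsubseteq> u \<squnion> y" using that y le' by (simp add: join_left le_joinI2)
    then have "p \<sqsubseteq> u \<squnion> y" using that y le_trans[OF that(3)] by simp
    then show "u \<in> ?S" using that le' x le_trans[OF that(2) le'(1)] by simp
  qed (use that in simp)
  have min_y': "v = y'" if "v \<in> carrier L" "v \<sqsubseteq> y'" "p \<sqsubseteq> x' \<squnion> v" for v
    using that le' y le_trans[OF that(2) le'(2)] by (intro min_y) simp_all
  have nle: "\<not> p \<sqsubseteq> x'" "\<not> p \<sqsubseteq> y'"
    using le' assms cl by (meson le_trans)+
  \<comment> \<open>Cutting \<open>y'\<close> down to \<open>y' \<sqinter> (x' \<squnion> p)\<close>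
    keeps \<open>p\<close> below the join with \<open>x'\<close>, so minimality makes the cut
    trivial.\<close>
  have y'_le: "y' \<sqsubseteq> x' \<squnion> p"
  proof -
    have "x' \<squnion> (y' \<sqinter> (x' \<squnion> p)) = (x' \<squnion> y') \<sqinter> (x' \<squnion> p)"
      by (rule modular_law) (simp_all add: join_left)
    then have "p \<sqsubseteq> x' \<squnion> (y' \<sqinter> (x' \<squnion> p))" using le' by (simp add: join_right)
    then have "y' \<sqinter> (x' \<squnion> p) = y'" by (intro min_y') (simp_all add: meet_left)
    then show ?thesis by (metis cl join_closed meet_right)
  qed
  have x'_le: "x' \<sqsubseteq> y' \<squnion> p"
  proof -
    have "y' \<squnion> (x' \<sqinter> (y' \<squnion> p)) = (y' \<squnion> x') \<sqinter> (y' \<squnion> p)"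
      by (rule modular_law) (simp_all add: join_left)
    then have "p \<sqsubseteq> y' \<squnion> (x' \<sqinter> (y' \<squnion> p))"
      using le'(3) by (simp add: join_right join_comm[of L y' x'])
    then have "p \<sqsubseteq> (x' \<sqinter> (y' \<squnion> p)) \<squnion> y'"
      by (simp only: join_comm)
    then have "x' \<sqinter> (y' \<squnion> p) = x'" by (intro min_x') (simp_all add: meet_left)
    then show ?thesis by (metis cl join_closed meet_right)
  qed
  \<comment> \<open>Irreducibility is inherited from \<open>p\<close>: over \<open>y'\<close>, a
    decomposition of \<open>x'\<close> would place \<open>p\<close> below the join of
    \<open>y'\<close> with one of the parts, so that part is \<open>x'\<close> by
    minimality.\<close>
  have "x' \<in> J"
  proof (rule irreducibleI[of x' y'])
    show "\<not> x' \<sqsubseteq> y'" using le' nle le_trans[OF le'(3), of y'] by auto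
    fix a b assume ab: "a \<in> carrier L" "b \<in> carrier L" "x' = a \<squnion> b"
    then have le: "a \<sqsubseteq> x'" "b \<sqsubseteq> x'" by (simp_all add: join_left join_right)
    then have "p \<sqsubseteq> y' \<squnion> a \<or> p \<sqsubseteq> y' \<squnion> b"
      using ab x'_le le'(3) p
      by (intro irreducible_le_over) (auto intro: le_trans simp: join_comm[of L y'])
    then show "x' = a \<or> x' = b"
      using min_x'[of a] min_x'[of b] le ab by (auto simp: join_comm[of L y'])
  qed simp_all
  moreover have "y' \<in> J"
  proof (rule irreducibleI[of y' x'])
    show "\<not> y' \<sqsubseteq> x'" using le' nle le_trans[OF le'(3), of x'] by auto
    fix a b assume ab: "a \<in> carrier L" "b \<in> carrier L" "y' = a \<squnion> b"
    then have le: "a \<sqsubseteq> y'" "b \<sqsubseteq> y'" by (simp_all add: join_left join_right)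
    then have "p \<sqsubseteq> x' \<squnion> a \<or> p \<sqsubseteq> x' \<squnion> b"
      using ab y'_le le'(3) p
      by (intro irreducible_le_over) (auto intro: le_trans)
    then show "y' = a \<or> y' = b"
      using min_y'[of a] min_y'[of b] le ab by auto
  qed simp_all
  moreover have "C x' y' p"
  proof -
    have "\<not> x' \<sqsubseteq> y'" using le' nle le_trans[OF le'(3), of y'] by auto
    moreover have "\<not> y' \<sqsubseteq> x'" using le' nle le_trans[OF le'(3), of x'] by auto
    \<comment> \<open>If \<open>x'\<close> were below \<open>p\<close>, then
      \<open>irreducible_shrink\<close> over \<open>y'\<close> would give \<open>x' = p\<close>,
      although \<open>p\<close> is not below \<open>x'\<close>.\<close>
    moreover have "\<not> x' \<sqsubseteq> p"
      using irreducible_shrink[OF p, of y' x'] nle le' by (auto simp: join_comm)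
    moreover have "\<not> y' \<sqsubseteq> p"
      using irreducible_shrink[OF p, of x' y'] nle le' by auto
    ultimately show ?thesis
      using nle x'_le y'_le le' by (simp add: collinear_iff incomparable_def join_comm[of L p])
  qed
  ultimately show thesis using that le' by blast
qed

section \<open>The Weak Triangle axiom in a modular lattice\<close>

lemma le_join_trans:
  assumes "x \<sqsubseteq> u \<squnion> v" "u \<sqsubseteq> w" "v \<sqsubseteq> w"
    and "x \<in> carrier L" "u \<in> carrier L" "v \<in> carrier L" "w \<in> carrier L"
  shows "x \<sqsubseteq> w"
  using assms le_trans[OF assms(1), of w] by simp

lemma collinearD:
  assumes "C x y z" "x \<in> J" "y \<in> J" "z \<in> J"
  shows "x \<sqsubseteq> y \<squnion> z" "x \<sqsubseteq> z \<squnion> y" "y \<sqsubseteq> x \<squnion> z" "y \<sqsubseteq> z \<squnion> x" "z \<sqsubseteq> x \<squnion> y" "z \<sqsubseteq> y \<squnion> x"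
    and "\<not> x \<sqsubseteq> y" "\<not> y \<sqsubseteq> x" "\<not> x \<sqsubseteq> z" "\<not> z \<sqsubseteq> x" "\<not> y \<sqsubseteq> z" "\<not> z \<sqsubseteq> y"
  using assms by (simp_all add: collinear_iff incomparable_def join_comm)

lemma collinearI:
  assumes "x \<in> J" "y \<in> J" "z \<in> J" "x \<sqsubseteq> y \<squnion> z" "y \<sqsubseteq> x \<squnion> z" "z \<sqsubseteq> x \<squnion> y"
    and "\<not> x \<sqsubseteq> y" "\<not> y \<sqsubseteq> x" "\<not> x \<sqsubseteq> z" "\<not> z \<sqsubseteq> x" "\<not> y \<sqsubseteq> z" "\<not> z \<sqsubseteq> y"
  shows "C x y z"
  using assms by (simp add: collinear_iff incomparable_def join_comm)

text \<open>Produces alternatives (ii) and (iii) of the Weak Triangle axiom: under these conditions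
  \<open>z\<close> can replace \<open>c\<close> on the line through \<open>b\<close> and
  \<open>q\<close>. The hard inequality is \<open>c \<sqsubseteq> q \<squnion> z\<close>.\<close>

lemma collinear_exchange:
  assumes J: "b \<in> J" "c \<in> J" "q \<in> J" "z \<in> J" and col: "C b c q"
    and z: "z \<sqsubseteq> b \<squnion> c" and b: "\<not> b \<sqsubseteq> c \<squnion> z" and c: "c \<sqsubseteq> b \<squnion> z"
  shows "C b q z"
proof -
  note D = collinearD[OF col J(1-3)]
  note cl [simp] = J[THEN J_closed]
  note [simp] = join_left join_right
  have q: "q \<sqsubseteq> b \<squnion> z" by (rule le_join_trans[OF D(5)]) (simp_all add: c)
  have zq: "\<not> z \<sqsubseteq> q"
  proof
    assume "z \<sqsubseteq> q"
    then have "z = q" using irreducible_shrink[OF J(3), of b z] q D by simp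
    then show False using b D by simp
  qed
  have c_le: "c \<sqsubseteq> q \<squnion> z"
  proof (rule ccontr)
    assume nc: "\<not> c \<sqsubseteq> q \<squnion> z"
    have "z \<sqsubseteq> c \<squnion> q" by (rule le_join_trans[OF z]) (simp_all add: D)
    moreover have "\<not> z \<sqsubseteq> c"
      using irreducible_shrink[OF J(2), of b z] c D nc by auto
    ultimately obtain c' q' where c'q': "c' \<in> J" "q' \<in> J" "c' \<sqsubseteq> c" "q' \<sqsubseteq> q" "C c' q' z"
      using irreducible_le_join[of z c q] zq J by auto
    note cl' [simp] = c'q'(1,2)[THEN J_closed]
    note D' = collinearD[OF c'q'(5,1,2) J(4)]
    have le: "c' \<sqsubseteq> b \<squnion> c" "q' \<sqsubseteq> b \<squnion> c"
      using le_trans[OF c'q'(3)] le_trans[OF c'q'(4)] D by simp_all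
    have "c' \<sqsubseteq> b \<squnion> (c' \<squnion> q')" "q' \<sqsubseteq> b \<squnion> (c' \<squnion> q')"
      by (simp_all add: le_joinI2)
    then have "z \<sqsubseteq> b \<squnion> (c' \<squnion> q')" using le_join_trans[OF D'(5)] by simp
    then have "c \<sqsubseteq> b \<squnion> (c' \<squnion> q')" using le_join_trans[OF c] by simp
    \<comment> \<open>The point \<open>z\<close> was resolved into \<open>c'\<close> below
      \<open>c\<close> and \<open>q'\<close> below \<open>q\<close>. Irreducibility of
      \<open>c\<close> over \<open>b\<close> keeps one of them, and shrinking promotes it to
      \<open>c\<close> or to \<open>q\<close>; both contradict the assumptions.\<close>
    then consider "c \<sqsubseteq> b \<squnion> c'" | "c \<sqsubseteq> b \<squnion> q'"
      using irreducible_le_over[OF J(2), of b c' q'] le by auto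
    then show False
    proof cases
      case 1
      then have "c' = c" using irreducible_shrink[OF J(2), of b c'] D c'q' by simp
      moreover have "q' \<sqsubseteq> q \<squnion> z" using c'q' by (simp add: le_joinI1)
      ultimately have "c \<sqsubseteq> q \<squnion> z" using le_join_trans[OF D'(1)] by simp
      then show False using nc by simp
    next
      case 2
      then have "q \<sqsubseteq> b \<squnion> q'" using le_join_trans[OF D(5)] by simp
      then have "q' = q" using irreducible_shrink[OF J(3), of b q'] D c'q' by simp
      moreover have "c' \<sqsubseteq> c \<squnion> z" using c'q' by (simp add: le_joinI1)
      ultimately have "q \<sqsubseteq> c \<squnion> z" using le_join_trans[OF D'(3)] by simp
      then show False using b le_join_trans[OF D(1)] by simp
    qed
  qed
  show ?thesis
  proof (rule collinearI)
    show "b \<sqsubseteq> q \<squnion> z" by (rule le_join_trans[OF D(1)]) (simp_all add: c_le)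
    show "z \<sqsubseteq> b \<squnion> q" by (rule le_join_trans[OF z]) (simp_all add: D)
    show "\<not> b \<sqsubseteq> z" using b le_joinI2[of b z c] by auto
    show "\<not> z \<sqsubseteq> b" using le_join_trans[OF c, of b] D by auto
    show "\<not> q \<sqsubseteq> z" using b le_join_trans[OF D(1), of "c \<squnion> z"] le_joinI2[of q z c] by auto
  qed (use J D q zq in simp_all)
qed

text \<open>By contradiction: the failure of (ii) to (v) keeps points off the joins spanned by the
  lines. These non-inequalities exclude the unwanted halves in the irreducibility arguments for the
  sixth point, and they exclude further collinear triples.\<close>

lemma irreducible_weak_triangle:
  assumes J: "a \<in> J" "b \<in> J" "c \<in> J" "p \<in> J" "q \<in> J"
    and acp: "C a c p" and bcq: "C b c q"
  shows "(\<exists>x\<in>J. triangle_configuration (irreducible_pip L) a b c p q x)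
    \<or> (\<exists>a'\<in>J. a' \<sqsubseteq> a \<and> C b q a')
    \<or> C b q p
    \<or> (\<exists>a'\<in>J. \<exists>p'\<in>J. a' \<sqsubseteq> a \<and> p' \<sqsubseteq> p \<and> C q a' p')
    \<or> q \<sqsubseteq> a \<or> q \<sqsubseteq> p"
proof (rule ccontr)
  assume neg: "\<not> ?thesis"
  note cl [simp] = J[THEN J_closed]
  note [simp] = join_left join_right
  note A = collinearD[OF acp J(1,3,4)] and B = collinearD[OF bcq J(2,3,5)]
  \<comment> \<open>Failure of (iv) and (v) enters here. Moving along the lines
    \<open>a, c, p\<close> and \<open>b, c, q\<close> then gives the next facts.\<close>
  have q_ap: "\<not> q \<sqsubseteq> a \<squnion> p"
  proof
    assume "q \<sqsubseteq> a \<squnion> p"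
    then obtain a' p' where "a' \<in> J" "p' \<in> J" "a' \<sqsubseteq> a" "p' \<sqsubseteq> p" "C a' p' q"
      using irreducible_le_join[of q a p] neg J by auto
    moreover from this have "C q a' p'"
      using J by (auto intro!: collinearI dest: collinearD)
    ultimately show False using neg by blast
  qed
  have q_ac: "\<not> q \<sqsubseteq> a \<squnion> c" using q_ap le_join_trans[of q a c "a \<squnion> p"] A by auto
  have b_ac: "\<not> b \<sqsubseteq> a \<squnion> c" using q_ac le_join_trans[OF B(5), of "a \<squnion> c"] by auto
  have q_pc: "\<not> q \<sqsubseteq> p \<squnion> c" using q_ac le_join_trans[of q p c "a \<squnion> c"] A by auto
  have b_pc: "\<not> b \<sqsubseteq> p \<squnion> c" using q_pc le_join_trans[OF B(5), of "p \<squnion> c"] by auto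
  \<comment> \<open>Failure of (ii) enters here: otherwise an irreducible \<open>x\<close> below
    \<open>a \<sqinter> (b \<squnion> c)\<close> could replace \<open>c\<close>, giving
    \<open>C b q x\<close>.\<close>
  have c_ab: "\<not> c \<sqsubseteq> a \<squnion> b"
  proof
    assume c: "c \<sqsubseteq> a \<squnion> b"
    let ?w = "a \<sqinter> (b \<squnion> c)"
    have "b \<squnion> ?w = (b \<squnion> a) \<sqinter> (b \<squnion> c)" by (rule modular_law) simp_all
    then have "c \<sqsubseteq> b \<squnion> ?w" using c by (simp add: join_comm[of L b a])
    then obtain x where x: "x \<in> J" "x \<sqsubseteq> ?w" "c \<sqsubseteq> b \<squnion> x"
      using irreducible_below_over[of c b ?w] J B by (auto simp: meet_right)
    note [simp] = x(1)[THEN J_closed]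
    from x have xle: "x \<sqsubseteq> a" "x \<sqsubseteq> b \<squnion> c" by simp_all
    have "\<not> b \<sqsubseteq> c \<squnion> x"
      using b_ac le_join_trans[of b c x "a \<squnion> c"] le_joinI1[OF xle(1)] by auto
    then have "C b q x" using collinear_exchange[OF J(2,3,5) x(1) bcq] x xle by simp
    then show False using neg x xle by blast
  qed
  \<comment> \<open>Failure of (iii) enters here: otherwise irreducibility of \<open>c\<close> over
    \<open>b\<close> leaves only \<open>c \<sqsubseteq> b \<squnion> p\<close>, and the exchange
    yields \<open>C b q p\<close>.\<close>
  have a_bc: "\<not> a \<sqsubseteq> b \<squnion> c"
  proof
    assume a: "a \<sqsubseteq> b \<squnion> c"
    then have p: "p \<sqsubseteq> b \<squnion> c" using le_join_trans[OF A(5)] by simp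
    have "a \<sqsubseteq> b \<squnion> (a \<squnion> p)" "p \<sqsubseteq> b \<squnion> (a \<squnion> p)" by (simp_all add: le_joinI2)
    then have "c \<sqsubseteq> b \<squnion> (a \<squnion> p)" using le_join_trans[OF A(3)] by simp
    then have "c \<sqsubseteq> b \<squnion> a \<or> c \<sqsubseteq> b \<squnion> p"
      using irreducible_le_over[OF J(3), of b a p] a p by auto
    then have "c \<sqsubseteq> b \<squnion> p" using c_ab by (simp add: join_comm)
    then have "C b q p"
      using collinear_exchange[OF J(2,3,5,4) bcq p] b_pc by (simp add: join_comm[of L c p])
    then show False using neg by blast
  qed
  have p_bc: "\<not> p \<sqsubseteq> b \<squnion> c" using a_bc le_join_trans[OF A(1), of "b \<squnion> c"] by auto
  have p_ab: "\<not> p \<sqsubseteq> a \<squnion> b" using c_ab le_join_trans[OF A(3), of "a \<squnion> b"] by auto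
  have q_ab: "\<not> q \<sqsubseteq> a \<squnion> b" using c_ab le_join_trans[OF B(3), of "a \<squnion> b"] by auto
  have p_q: "\<not> p \<sqsubseteq> q" using p_bc le_trans[of p q "b \<squnion> c"] B by auto
  have q_p: "\<not> q \<sqsubseteq> p" and q_a: "\<not> q \<sqsubseteq> a" using neg by auto
  \<comment> \<open>Otherwise all five points lie below \<open>p \<squnion> q\<close>.
    Irreducibility of \<open>p\<close> over \<open>q\<close> then puts them below
    \<open>a \<squnion> q\<close>, and irreducibility of \<open>q\<close> over \<open>a\<close>
    contradicts \<open>q_ab\<close> or \<open>q_ac\<close>.\<close>
  have a_pq: "\<not> a \<sqsubseteq> p \<squnion> q"
  proof
    assume a: "a \<sqsubseteq> p \<squnion> q"
    have c: "c \<sqsubseteq> p \<squnion> q" using le_join_trans[OF A(3)] a by simp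
    have b: "b \<sqsubseteq> p \<squnion> q" using le_join_trans[OF B(1)] c by simp
    have "p \<sqsubseteq> q \<squnion> (a \<squnion> c)" using A by (simp add: le_joinI2)
    then have "p \<sqsubseteq> q \<squnion> a \<or> p \<sqsubseteq> q \<squnion> c"
      using irreducible_le_over[OF J(4), of q a c] a c by (auto simp: join_comm)
    moreover have "\<not> p \<sqsubseteq> q \<squnion> c"
      using p_bc le_join_trans[of p q c "b \<squnion> c"] B by auto
    ultimately have p: "p \<sqsubseteq> a \<squnion> q" by (simp add: join_comm)
    have bc: "b \<sqsubseteq> a \<squnion> q" "c \<sqsubseteq> a \<squnion> q"
      using le_join_trans[OF b] le_join_trans[OF c] p by simp_all
    have "q \<sqsubseteq> a \<squnion> (b \<squnion> c)" using B by (simp add: le_joinI2)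
    then have "q \<sqsubseteq> a \<squnion> b \<or> q \<sqsubseteq> a \<squnion> c"
      using irreducible_le_over[OF J(5), of a b c] bc by auto
    then show False using q_ab q_ac by blast
  qed
  have c_pq: "\<not> c \<sqsubseteq> p \<squnion> q" using a_pq le_join_trans[OF A(1), of "p \<squnion> q"] by auto
  have b_pq: "\<not> b \<sqsubseteq> p \<squnion> q" using c_pq le_join_trans[OF B(3), of "p \<squnion> q"] by auto
  have a_b: "\<not> a \<sqsubseteq> b" using a_bc le_joinI1[of a b c] by auto
  \<comment> \<open>The lattice meet of the two lines. It need not be irreducible, so the sixth
    point is taken among the irreducibles below it.\<close>
  let ?w = "(a \<squnion> b) \<sqinter> (p \<squnion> q)"
  have w: "?w \<sqsubseteq> a \<squnion> b" "?w \<sqsubseteq> p \<squnion> q" by (simp_all add: meet_left meet_right)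
  have c1: "c \<sqsubseteq> (a \<squnion> b) \<squnion> p" by (rule le_join_trans[OF A(3)]) (simp_all add: le_joinI1)
  have c2: "c \<sqsubseteq> (a \<squnion> b) \<squnion> q" by (rule le_join_trans[OF B(3)]) (simp_all add: le_joinI1)
  have c3: "c \<sqsubseteq> a \<squnion> (p \<squnion> q)" by (rule le_join_trans[OF A(3)]) (simp_all add: le_joinI2)
  have c4: "c \<sqsubseteq> b \<squnion> (p \<squnion> q)" by (rule le_join_trans[OF B(3)]) (simp_all add: le_joinI2)
  \<comment> \<open>Modularity evaluates \<open>a \<squnion> ?w\<close> as the part of
    \<open>a \<squnion> b\<close> below \<open>a \<squnion> (p \<squnion> q)\<close>. The same
    computation at \<open>b\<close>, \<open>p\<close> and \<open>q\<close> shows that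
    \<open>?w\<close> completes each of these points to its line.\<close>
  have over_a: "b \<sqsubseteq> a \<squnion> ?w"
  proof -
    have "b \<sqsubseteq> a \<squnion> (p \<squnion> q)"
      by (rule le_join_trans[OF B(1)]) (simp_all add: le_joinI2 c3)
    moreover have "a \<squnion> ((p \<squnion> q) \<sqinter> (a \<squnion> b)) = (a \<squnion> (p \<squnion> q)) \<sqinter> (a \<squnion> b)"
      by (rule modular_law) simp_all
    ultimately show ?thesis by (simp add: meet_comm)
  qed
  have over_b: "a \<sqsubseteq> b \<squnion> ?w"
  proof -
    have "a \<sqsubseteq> b \<squnion> (p \<squnion> q)"
      by (rule le_join_trans[OF A(1)]) (simp_all add: le_joinI2 c4)
    moreover have "b \<squnion> ((p \<squnion> q) \<sqinter> (a \<squnion> b)) = (b \<squnion> (p \<squnion> q)) \<sqinter> (a \<squnion> b)"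
      by (rule modular_law) simp_all
    ultimately show ?thesis by (simp add: meet_comm)
  qed
  have over_p: "q \<sqsubseteq> p \<squnion> ?w"
  proof -
    have "q \<sqsubseteq> (a \<squnion> b) \<squnion> p"
      by (rule le_join_trans[OF B(5)]) (simp_all add: le_joinI1 c1)
    moreover have "p \<squnion> ((a \<squnion> b) \<sqinter> (p \<squnion> q)) = (p \<squnion> (a \<squnion> b)) \<sqinter> (p \<squnion> q)"
      by (rule modular_law) simp_all
    ultimately show ?thesis by (simp add: join_comm)
  qed
  have over_q: "p \<sqsubseteq> q \<squnion> ?w"
  proof -
    have "p \<sqsubseteq> (a \<squnion> b) \<squnion> q"
      by (rule le_join_trans[OF A(5)]) (simp_all add: le_joinI1 c2)
    moreover have "q \<squnion> ((a \<squnion> b) \<sqinter> (p \<squnion> q)) = (q \<squnion> (a \<squnion> b)) \<sqinter> (p \<squnion> q)"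
      by (rule modular_law) simp_all
    ultimately show ?thesis by (simp add: join_comm)
  qed
  \<comment> \<open>The choice of \<open>x\<close> secures only the inequality over
    \<open>a\<close>; those over \<open>b\<close>, \<open>p\<close> and \<open>q\<close> have to be
    recovered from it.\<close>
  obtain x where x: "x \<in> J" "x \<sqsubseteq> ?w" and b_ax: "b \<sqsubseteq> a \<squnion> x"
    using irreducible_below_over[OF J(2), of a ?w] over_a w b_ac le_joinI1[of b a c] by auto
  note [simp] = x(1)[THEN J_closed]
  from x have x_ab: "x \<sqsubseteq> a \<squnion> b" and x_pq: "x \<sqsubseteq> p \<squnion> q" by simp_all
  \<comment> \<open>Once \<open>x\<close> and \<open>u\<close> together cover \<open>?w\<close>,
    modularity reduces \<open>?w\<close> to \<open>x\<close> and the part of \<open>u\<close> inside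
    \<open>?w\<close>.\<close>
  have w_split: "?w \<sqsubseteq> x \<squnion> (u \<sqinter> ?w)" if "u \<in> carrier L" "?w \<sqsubseteq> u \<squnion> x" for u
  proof -
    have "x \<squnion> (u \<sqinter> ?w) = (x \<squnion> u) \<sqinter> ?w" by (rule modular_law) (use x that in simp_all)
    then show ?thesis using that by (simp add: join_comm)
  qed
  have wa: "?w \<sqsubseteq> x \<squnion> (a \<sqinter> ?w)"
  proof (rule w_split)
    show "?w \<sqsubseteq> a \<squnion> x" by (rule le_join_trans[OF w(1)]) (simp_all add: b_ax)
  qed simp
  \<comment> \<open>Irreducibility of \<open>a\<close> over \<open>b\<close>, applied to
    \<open>x\<close> and \<open>a \<sqinter> ?w\<close>. If the latter sufficed, shrinking would put
    \<open>a\<close> itself below \<open>?w\<close>, against \<open>a_pq\<close>.\<close>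
  have a_bx: "a \<sqsubseteq> b \<squnion> x"
  proof -
    have "b \<squnion> ?w \<sqsubseteq> b \<squnion> (x \<squnion> (a \<sqinter> ?w))" using wa by (simp add: le_joinI2)
    then have "a \<sqsubseteq> b \<squnion> (x \<squnion> (a \<sqinter> ?w))" using le_trans[OF over_b] by simp
    moreover have "a \<sqinter> ?w \<sqsubseteq> b \<squnion> a" by (simp add: le_joinI2 meet_left)
    ultimately have "a \<sqsubseteq> b \<squnion> x \<or> a \<sqsubseteq> b \<squnion> (a \<sqinter> ?w)"
      using irreducible_le_over[OF J(1), of b x "a \<sqinter> ?w"] x_ab by (simp add: join_comm[of L b a])
    moreover have "\<not> a \<sqsubseteq> b \<squnion> (a \<sqinter> ?w)"
    proof
      assume "a \<sqsubseteq> b \<squnion> (a \<sqinter> ?w)"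
      then have "a \<sqinter> ?w = a" using irreducible_shrink[OF J(1), of b "a \<sqinter> ?w"] a_b by (simp add: meet_left)
      then have "a \<sqsubseteq> ?w" using meet_right[of a ?w] by simp
      then show False using a_pq by simp
    qed
    ultimately show ?thesis by blast
  qed
  \<comment> \<open>The same splitting; the unwanted half would place \<open>q\<close> below
    \<open>a \<squnion> p\<close>, against \<open>q_ap\<close>.\<close>
  have q_px: "q \<sqsubseteq> p \<squnion> x"
  proof -
    have "p \<squnion> ?w \<sqsubseteq> p \<squnion> (x \<squnion> (a \<sqinter> ?w))" using wa by (simp add: le_joinI2)
    then have "q \<sqsubseteq> p \<squnion> (x \<squnion> (a \<sqinter> ?w))" using le_trans[OF over_p] by simp
    moreover have "a \<sqinter> ?w \<sqsubseteq> p \<squnion> q" using le_trans[OF meet_right[of a ?w] w(2)] by simp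
    ultimately have "q \<sqsubseteq> p \<squnion> x \<or> q \<sqsubseteq> p \<squnion> (a \<sqinter> ?w)"
      using irreducible_le_over[OF J(5), of p x "a \<sqinter> ?w"] x_pq by simp
    moreover have "p \<squnion> (a \<sqinter> ?w) \<sqsubseteq> a \<squnion> p" by (simp add: le_joinI1 meet_left)
    ultimately show ?thesis using q_ap le_trans[of q "p \<squnion> (a \<sqinter> ?w)" "a \<squnion> p"] by auto
  qed
  have wp: "?w \<sqsubseteq> x \<squnion> (p \<sqinter> ?w)"
  proof (rule w_split)
    show "?w \<sqsubseteq> p \<squnion> x" by (rule le_join_trans[OF w(2)]) (simp_all add: q_px)
  qed simp
  have p_qx: "p \<sqsubseteq> q \<squnion> x"
  proof -
    have "q \<squnion> ?w \<sqsubseteq> q \<squnion> (x \<squnion> (p \<sqinter> ?w))" using wp by (simp add: le_joinI2)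
    then have "p \<sqsubseteq> q \<squnion> (x \<squnion> (p \<sqinter> ?w))" using le_trans[OF over_q] by simp
    moreover have "p \<sqinter> ?w \<sqsubseteq> q \<squnion> p" by (simp add: le_joinI2 meet_left)
    ultimately have "p \<sqsubseteq> q \<squnion> x \<or> p \<sqsubseteq> q \<squnion> (p \<sqinter> ?w)"
      using irreducible_le_over[OF J(4), of q x "p \<sqinter> ?w"] x_pq by (simp add: join_comm[of L q p])
    moreover have "\<not> p \<sqsubseteq> q \<squnion> (p \<sqinter> ?w)"
    proof
      assume "p \<sqsubseteq> q \<squnion> (p \<sqinter> ?w)"
      then have "p \<sqinter> ?w = p" using irreducible_shrink[OF J(4), of q "p \<sqinter> ?w"] p_q by (simp add: meet_left)
      then have "p \<sqsubseteq> ?w" using meet_right[of p ?w] by simp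
      then show False using p_ab by simp
    qed
    ultimately show ?thesis by blast
  qed
  have x_ac: "\<not> x \<sqsubseteq> a \<squnion> c" using b_ac le_join_trans[OF b_ax, of "a \<squnion> c"] by auto
  have x_bc: "\<not> x \<sqsubseteq> b \<squnion> c" using a_bc le_join_trans[OF a_bx, of "b \<squnion> c"] by auto
  have nle1: "\<not> u \<sqsubseteq> v" if "\<not> u \<sqsubseteq> v \<squnion> t" "u \<in> J" "v \<in> J" "t \<in> J" for u v t
    using that le_joinI1[of u v t] by auto
  have nle2: "\<not> u \<sqsubseteq> v" if "\<not> u \<sqsubseteq> t \<squnion> v" "u \<in> J" "v \<in> J" "t \<in> J" for u v t
    using that le_joinI2[of u v t] by auto
  have nle3: "\<not> u \<sqsubseteq> x" if "\<not> u \<sqsubseteq> p \<squnion> q \<or> \<not> u \<sqsubseteq> a \<squnion> b" "u \<in> J" for u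
    using that x_ab x_pq le_trans[of u x] by auto
  have inc:
    "\<not> a \<sqsubseteq> q" "\<not> q \<sqsubseteq> a" "\<not> b \<sqsubseteq> p" "\<not> p \<sqsubseteq> b" "\<not> a \<sqsubseteq> b" "\<not> b \<sqsubseteq> a"
    "\<not> p \<sqsubseteq> q" "\<not> q \<sqsubseteq> p" "\<not> a \<sqsubseteq> x" "\<not> b \<sqsubseteq> x" "\<not> c \<sqsubseteq> x" "\<not> p \<sqsubseteq> x" "\<not> q \<sqsubseteq> x"
    "\<not> x \<sqsubseteq> a" "\<not> x \<sqsubseteq> b" "\<not> x \<sqsubseteq> c"
    using nle2[OF a_pq] q_a nle1[OF b_pc] nle1[OF p_bc] a_b nle1[OF b_ac] p_q q_p
      nle3[of a] nle3[of b] nle3[of c] nle3[of p] nle3[of q]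
      a_pq b_pq c_pq p_ab q_ab nle1[OF x_ac] nle1[OF x_bc] nle2[OF x_bc] J x by simp_all
  have inc': "\<not> x \<sqsubseteq> p" "\<not> x \<sqsubseteq> q"
    using le_join_trans[OF q_px, of p] le_join_trans[OF p_qx, of q] p_q q_p by auto
  have colx: "C a b x" "C p q x"
    by (rule collinearI; use J x inc inc' x_ab x_pq a_bx b_ax p_qx q_px in simp)+
  have inc_all: "\<forall>u\<in>{a, b, c, p, q, x}. \<forall>v\<in>{a, b, c, p, q, x}. u \<noteq> v \<longrightarrow> \<not> u \<sqsubseteq> v"
    using inc inc' A(7-12) B(7-12) by simp
  have dist: "distinct [a, b, c, p, q, x]"
    using inc inc' A(7-12) B(7-12) by auto
  let ?N = "{a, b, c, p, q, x}"
  let ?T = "{{a, c, p}, {b, c, q}, {a, b, x}, {p, q, x}}"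
  note NJ [simp] = J x(1)
  \<comment> \<open>A bound \<open>g\<close> of all points of \<open>K\<close> also bounds every
    point collinear with two of them, so a point not below \<open>g\<close> cannot be such a third
    point.\<close>
  have off_line: "\<not> C u v z"
    if "\<And>t. t \<in> K \<Longrightarrow> t \<in> J \<and> t \<sqsubseteq> g" "g \<in> carrier L" "z \<in> J" "\<not> z \<sqsubseteq> g" "u \<in> K" "v \<in> K"
    for K g u v z
    using that collinearD(5)[of u v z] le_join_trans[of z u v g] by auto
  have off_lines: "\<not> C u v z" if K: "K \<in> ?T" "u \<in> K" "v \<in> K" "z \<in> ?N" "z \<notin> K" for u v z K
  proof -
    consider "K = {a, c, p}" | "K = {b, c, q}" | "K = {a, b, x}" | "K = {p, q, x}" using K(1) by blast
    then show ?thesis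
    proof cases
      case 1
      then show ?thesis
        using K A(5) b_ac q_ac x_ac by (intro off_line[of K "a \<squnion> c"]) auto
    next
      case 2
      then show ?thesis
        using K B(5) a_bc p_bc x_bc by (intro off_line[of K "b \<squnion> c"]) auto
    next
      case 3
      then show ?thesis
        using K x_ab c_ab p_ab q_ab by (intro off_line[of K "a \<squnion> b"]) auto
    next
      case 4
      then show ?thesis
        using K x_pq a_pq b_pq c_pq by (intro off_line[of K "p \<squnion> q"]) auto
    qed
  qed
  \<comment> \<open>Opposite vertices of the complete quadrilateral: \<open>a\<close> and
    \<open>q\<close>, \<open>b\<close> and \<open>p\<close>, \<open>c\<close> and \<open>x\<close>
    are the three pairs that lie on none of the four lines.\<close>
  define opp where "opp = id(a := q, q := a, b := p, p := b, c := x, x := c)"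
  have pair: "(\<exists>K\<in>?T. u \<in> K \<and> v \<in> K) \<or> v = opp u" if "u \<in> ?N" "v \<in> ?N" "u \<noteq> v" for u v
    using that dist by (elim insertE emptyE; simp add: opp_def)
  have on_line: "{u, v, w} \<in> ?T" if N: "u \<in> ?N" "v \<in> ?N" "w \<in> ?N" and col: "C u v w" for u v w
  proof -
    have "?N \<subseteq> J" by simp
    then have uvw: "u \<in> J" "v \<in> J" "w \<in> J" using N by (meson subsetD)+
    note D = collinearD[OF col uvw]
    have ne: "u \<noteq> v" "u \<noteq> w" "v \<noteq> w" using D(7,9,11) le_refl uvw J_closed by metis+
    have col': "C u w v" using uvw D by (intro collinearI) simp_all
    \<comment> \<open>As \<open>u\<close> has a single opposite vertex, it shares a listed line
      \<open>K\<close> with \<open>v\<close> or with \<open>w\<close>; \<open>off_lines\<close> then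
      forces the remaining point onto \<open>K\<close>.\<close>
    have "v \<noteq> opp u \<or> w \<noteq> opp u" using ne by metis
    then obtain K where K: "K \<in> ?T" and "u \<in> K \<and> v \<in> K \<or> u \<in> K \<and> w \<in> K"
      using pair[OF N(1,2) ne(1)] pair[OF N(1,3) ne(2)] by metis
    then have "{u, v, w} \<subseteq> K"
      using off_lines[OF K, of u v w] off_lines[OF K, of u w v] col col' N by blast
    have "finite K \<and> card K \<le> 3" using K by (auto simp: card_insert_if)
    moreover have "card {u, v, w} = 3" using ne by simp
    ultimately have "{u, v, w} = K" using \<open>{u, v, w} \<subseteq> K\<close> by (metis card_seteq)
    then show ?thesis using K by simp
  qed
  have "triangle_configuration (irreducible_pip L) a b c p q x"
    unfolding triangle_configuration_def
  proof (intro conjI)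
    show "\<forall>u\<in>?N. \<forall>v\<in>?N. u \<noteq> v \<longrightarrow> incomparable (irreducible_pip L) u v"
      using inc_all unfolding incomparable_def le_irreducible_pip by metis
    show "\<forall>u\<in>?N. \<forall>v\<in>?N. \<forall>w\<in>?N. C u v w \<longrightarrow> {u, v, w} \<in> ?T"
      by (intro ballI impI on_line)
  qed (rule colx dist)+
  then show False using neg x(1) by blast
qed
end


section \<open>Modular semilattices of finite length\<close>

lemma (in partial_order) sup_eqI:
  assumes "least L s (Upper L A)"
  shows "\<Squnion>A = s"
  unfolding sup_def using assms weak_least_unique unfolding eq_is_equal
  by (metis (mono_tags, lifting) someI)

text \<open>Replaces the total operation \<open>\<squnion>\<close>, defined by choice, by a common
  least upper bound. In this form collinearity can be compared between \<open>L\<close> and its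
  principal ideals.\<close>

lemma (in partial_order) collinear_irreducible_pip_iff:
  "collinear (irreducible_pip L) x y z \<longleftrightarrow>
    incomparable L x y \<and> incomparable L y z \<and> incomparable L x z \<and>
    (\<exists>s. least L s (Upper L {x, y}) \<and> least L s (Upper L {y, z}) \<and> least L s (Upper L {z, x}))"
proof -
  have "has_join L {u, v} \<longleftrightarrow> least L (u \<squnion> v) (Upper L {u, v})" for u v
    unfolding has_join_def join_def by (metis sup_eqI)
  moreover have "least L s (Upper L {u, v}) \<Longrightarrow> u \<squnion> v = s" for s u v
    unfolding join_def by (rule sup_eqI)
  ultimately show ?thesis by (simp add: irreducible_pip_def) metis
qed

lemma carrier_consistent_subspaces [simp]:
    "X \<in> carrier (consistent_subspaces P) \<longleftrightarrow> subspace P X \<and> consistent P X"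
  and le_consistent_subspaces [simp]: "X \<sqsubseteq>\<^bsub>consistent_subspaces P\<^esub> Y \<longleftrightarrow> X \<subseteq> Y"
  and eq_consistent_subspaces [simp]: "eq (consistent_subspaces P) = (=)"
  by (simp_all add: consistent_subspaces_def)

lemma partial_order_consistent_subspaces: "partial_order (consistent_subspaces P)"
  by unfold_locales auto

locale finite_length_modular_semilattice = modular_semilattice +
  assumes finite_length: "finite_length L"
begin

abbreviation J :: "'a set" where "J \<equiv> join_irreducibles L"

lemma J_closed [simp, intro]: "p \<in> J \<Longrightarrow> p \<in> carrier L"
  by (rule join_irreducibles_closed)

section \<open>Transfer between the semilattice and its principal ideals\<close>

lemma carrier_ideal [simp]: "x \<in> carrier (principal_ideal L u) \<longleftrightarrow> x \<in> carrier L \<and> x \<sqsubseteq> u"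
  and le_ideal [simp]: "le (principal_ideal L u) = le L"
  and incomparable_ideal [simp]: "incomparable (principal_ideal L u) = incomparable L"
  by (simp_all add: principal_ideal_def incomparable_def fun_eq_iff)

lemma finite_length_modular_lattice_ideal:
  assumes "u \<in> carrier L"
  shows "finite_length_modular_lattice (principal_ideal L u)"
proof -
  interpret I: modular_lattice "principal_ideal L u" by (rule principal_ideal_modular[OF assms])
  show ?thesis
    by unfold_locales (rule finite_length_mono[OF finite_length], auto)
qed

text \<open>Any upper bound \<open>v\<close> of \<open>A\<close> may be replaced by
  \<open>v \<sqinter> u\<close>, an upper bound inside the ideal, so leastness can be tested
  there.\<close>

lemma least_Upper_ideal:
  assumes u: "u \<in> carrier L" and A: "A \<subseteq> carrier (principal_ideal L u)"
  shows "least (principal_ideal L u) s (Upper (principal_ideal L u) A) \<longleftrightarrow> least L s (Upper L A)"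
proof -
  have A': "x \<in> carrier L" "x \<sqsubseteq> u" if "x \<in> A" for x using that A by auto
  have U: "v \<in> Upper (principal_ideal L u) A \<longleftrightarrow> v \<in> Upper L A \<and> v \<sqsubseteq> u" for v
    using A' by (auto simp: Upper_def)
  have "u \<in> Upper L A" using A' u by (auto simp: Upper_def)
  moreover have "s \<sqsubseteq> v"
    if s: "s \<in> carrier L" and v: "v \<in> Upper L A" and le: "s \<sqsubseteq> v \<sqinter> u" for v
    using le_trans[OF le meet_left] s v u by (auto simp: Upper_def)
  moreover have "v \<sqinter> u \<in> Upper L A \<and> v \<sqinter> u \<sqsubseteq> u" if "v \<in> Upper L A" for v
    using that A' u by (auto simp: Upper_def meet_right intro: meet_le)
  ultimately show ?thesis
    unfolding least_def using U Upper_closed[of "principal_ideal L u" A] Upper_closed[of L A]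
    by (smt (verit, best) le_ideal subsetD)
qed

lemma least_ideal:
  assumes u: "u \<in> carrier L" and l: "l \<in> carrier L" "l \<sqsubseteq> u"
  shows "least (principal_ideal L u) l (carrier (principal_ideal L u)) \<longleftrightarrow> least L l (carrier L)"
  using least_Upper_ideal[OF u, of "{}" l] by simp

text \<open>A decomposition of \<open>p\<close> uses only elements below \<open>p\<close>, and these
  already lie in the ideal.\<close>

lemma join_irreducibles_ideal:
  assumes u: "u \<in> carrier L"
  shows "join_irreducibles (principal_ideal L u) = {p \<in> J. p \<sqsubseteq> u}"
proof (rule Set.set_eqI)
  fix p
  have irr: "(\<forall>a\<in>carrier (principal_ideal L u). \<forall>b\<in>carrier (principal_ideal L u).
      least (principal_ideal L u) p (Upper (principal_ideal L u) {a, b}) \<longrightarrow> p = a \<or> p = b) \<longleftrightarrow>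
    (\<forall>a\<in>carrier L. \<forall>b\<in>carrier L. least L p (Upper L {a, b}) \<longrightarrow> p = a \<or> p = b)"
    if p: "p \<in> carrier L" "p \<sqsubseteq> u"
  proof -
    have below: "a \<in> carrier (principal_ideal L u) \<and> b \<in> carrier (principal_ideal L u)"
      if "a \<in> carrier L" "b \<in> carrier L" "least L p (Upper L {a, b})" for a b
      using that p u least_Upper_above[OF that(3)] by (auto intro: le_trans[of _ p u])
    have eq: "least (principal_ideal L u) p (Upper (principal_ideal L u) {a, b}) \<longleftrightarrow> least L p (Upper L {a, b})"
      if "a \<in> carrier (principal_ideal L u)" "b \<in> carrier (principal_ideal L u)" for a b
      using that by (intro least_Upper_ideal[OF u]) blast
    show ?thesis
    proof (intro iffI ballI impI)
      fix a b
      assume "\<forall>a\<in>carrier (principal_ideal L u). \<forall>b\<in>carrier (principal_ideal L u).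
          least (principal_ideal L u) p (Upper (principal_ideal L u) {a, b}) \<longrightarrow> p = a \<or> p = b"
        and "a \<in> carrier L" "b \<in> carrier L" "least L p (Upper L {a, b})"
      then show "p = a \<or> p = b" using below eq by blast
    next
      fix a b
      assume "\<forall>a\<in>carrier L. \<forall>b\<in>carrier L. least L p (Upper L {a, b}) \<longrightarrow> p = a \<or> p = b"
        and "a \<in> carrier (principal_ideal L u)" "b \<in> carrier (principal_ideal L u)"
        and "least (principal_ideal L u) p (Upper (principal_ideal L u) {a, b})"
      then show "p = a \<or> p = b" using eq by simp
    qed
  qed
  show "p \<in> join_irreducibles (principal_ideal L u) \<longleftrightarrow> p \<in> {p \<in> J. p \<sqsubseteq> u}"
  proof (cases "p \<in> carrier L \<and> p \<sqsubseteq> u")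
    case True
    then show ?thesis
      by (simp only: join_irreducibles_def mem_Collect_eq carrier_ideal irr least_ideal[OF u] simp_thms)
  next
    case False
    then show ?thesis using join_irreducibles_closed[of p "principal_ideal L u"] by auto
  qed
qed

lemma collinear_ideal:
  assumes u: "u \<in> carrier L" and "x \<in> carrier L" "x \<sqsubseteq> u" "y \<in> carrier L" "y \<sqsubseteq> u" "z \<in> carrier L" "z \<sqsubseteq> u"
  shows "collinear (irreducible_pip (principal_ideal L u)) x y z \<longleftrightarrow>
    collinear (irreducible_pip L) x y z"
proof -
  interpret I: finite_length_modular_lattice "principal_ideal L u"
    by (rule finite_length_modular_lattice_ideal[OF u])
  show ?thesis
    using assms by (simp add: I.collinear_irreducible_pip_iff collinear_irreducible_pip_iff least_Upper_ideal)
qed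

text \<open>Below a common upper bound there is a lattice whose joins are joins of \<open>L\<close>.
  Hence inconsistency of irreducibles means absence of a common upper bound, and this criterion
  serves for checking the axioms.\<close>

lemma has_join_iff_bounded:
  assumes "x \<in> carrier L" "y \<in> carrier L"
  shows "has_join L {x, y} \<longleftrightarrow> (\<exists>u\<in>carrier L. x \<sqsubseteq> u \<and> y \<sqsubseteq> u)"
proof
  assume "has_join L {x, y}"
  then show "\<exists>u\<in>carrier L. x \<sqsubseteq> u \<and> y \<sqsubseteq> u"
    using assms least_Upper_above least_closed unfolding has_join_def
    by (metis empty_subsetI insert_iff insert_subset)
next
  assume "\<exists>u\<in>carrier L. x \<sqsubseteq> u \<and> y \<sqsubseteq> u"
  then obtain u where u: "u \<in> carrier L" "x \<sqsubseteq> u" "y \<sqsubseteq> u" by blast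
  then interpret I: finite_length_modular_lattice "principal_ideal L u"
    using finite_length_modular_lattice_ideal by blast
  show "has_join L {x, y}"
    using I.has_join[of x y] u assms by (simp add: has_join_def least_Upper_ideal)
qed

lemma irreducible_below:
  assumes "l \<in> carrier L" "m \<in> carrier L" "\<not> l \<sqsubseteq> m"
  obtains p where "p \<in> J" "p \<sqsubseteq> l" "\<not> p \<sqsubseteq> m"
proof -
  interpret I: finite_length_modular_lattice "principal_ideal L l"
    by (rule finite_length_modular_lattice_ideal[OF assms(1)])
  have "\<not> l \<sqsubseteq> m \<sqinter> l" using assms le_trans[OF _ meet_left[of m l], of l] by auto
  with assms meet_right[of m l] obtain p where "p \<in> I.J" "\<not> p \<sqsubseteq> m \<sqinter> l"
    using I.irreducible_below[of l "m \<sqinter> l" thesis] by auto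
  then have "p \<in> J" "p \<sqsubseteq> l" "\<not> p \<sqsubseteq> m \<sqinter> l"
    using assms by (auto simp: join_irreducibles_ideal)
  then show thesis using that assms by (meson J_closed meet_le)
qed

text \<open>Everything involved lies below \<open>s\<close>, so the lattice version applies in the
  ideal of \<open>s\<close>.\<close>

lemma irreducible_le_join:
  assumes p: "p \<in> J" and xy: "x \<in> carrier L" "y \<in> carrier L"
    and s: "least L s (Upper L {x, y})" "p \<sqsubseteq> s"
    and "\<not> p \<sqsubseteq> x" "\<not> p \<sqsubseteq> y"
  obtains x' y' where "x' \<in> J" "y' \<in> J" "x' \<sqsubseteq> x" "y' \<sqsubseteq> y" "collinear (irreducible_pip L) x' y' p"
proof -
  have sC: "s \<in> carrier L" using s by simp
  have le: "x \<sqsubseteq> s" "y \<sqsubseteq> s" using least_Upper_above[OF s(1)] xy by auto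
  interpret I: finite_length_modular_lattice "principal_ideal L s"
    by (rule finite_length_modular_lattice_ideal[OF sC])
  have "join (principal_ideal L s) x y = s"
    unfolding join_def using s xy le sC by (intro I.sup_eqI) (simp add: least_Upper_ideal)
  moreover have "p \<in> I.J" using p s sC by (simp add: join_irreducibles_ideal)
  ultimately obtain x' y' where x'y': "x' \<in> I.J" "y' \<in> I.J" "x' \<sqsubseteq> x" "y' \<sqsubseteq> y" "I.C x' y' p"
    using I.irreducible_le_join[of p x y] assms le by auto
  then have "x' \<in> J" "x' \<sqsubseteq> s" "y' \<in> J" "y' \<sqsubseteq> s"
    using sC by (auto simp: join_irreducibles_ideal)
  then show thesis using that x'y' p s sC collinear_ideal[of s x' y' p] by auto
qed

lemma collinearD:
  assumes "collinear (irreducible_pip L) x y z" "x \<in> carrier L" "y \<in> carrier L" "z \<in> carrier L"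
  obtains s where "s \<in> carrier L" "least L s (Upper L {x, y})" "x \<sqsubseteq> s" "y \<sqsubseteq> s" "z \<sqsubseteq> s"
proof -
  obtain s where s: "least L s (Upper L {x, y})" "least L s (Upper L {y, z})"
    using assms(1) by (auto simp: collinear_irreducible_pip_iff)
  then show thesis
    using that[of s] least_Upper_above[OF s(1)] least_Upper_above[OF s(2)] assms by auto
qed

lemma collinear_least:
  assumes "collinear (irreducible_pip L) x y z" "x \<in> carrier L" "y \<in> carrier L" "z \<in> carrier L"
    and "x \<sqsubseteq> w" "y \<sqsubseteq> w" "w \<in> carrier L"
  shows "z \<sqsubseteq> w"
proof -
  obtain s where s: "s \<in> carrier L" "least L s (Upper L {x, y})" "z \<sqsubseteq> s"
    using collinearD[OF assms(1-4)] by blast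
  then have "s \<sqsubseteq> w" using assms by (intro least_le[OF s(2)] Upper_memI) auto
  then show ?thesis using assms s le_trans[of z s w] by blast
qed

lemma collinear_perm:
  assumes "collinear (irreducible_pip L) x y z"
  shows "collinear (irreducible_pip L) y x z" "collinear (irreducible_pip L) y z x"
  using assms unfolding collinear_irreducible_pip_iff incomparable_def by (auto simp: insert_commute)

lemma has_join_triple:
  assumes "x \<in> carrier L" "y \<in> carrier L" "z \<in> carrier L"
    and "has_join L {x, y}" "has_join L {y, z}" "has_join L {z, x}"
  obtains u where "u \<in> carrier L" "x \<sqsubseteq> u" "y \<sqsubseteq> u" "z \<sqsubseteq> u"
proof -
  obtain s where s: "least L s (Upper L {x, y, z})"
    using triple_join[OF assms] by (auto simp: has_join_def)
  then show thesis using that[of s] assms least_Upper_above[OF s] by auto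
qed

lemma collinear_incomparable:
  assumes "collinear (irreducible_pip L) x y z"
  shows "incomparable L x y" "incomparable L y z" "incomparable L x z"
  using assms by (simp_all add: collinear_irreducible_pip_iff)

section \<open>The axioms of a PPIP for the irreducible elements\<close>

lemma partial_order_irreducible_pip: "partial_order (irreducible_pip L)"
  by unfold_locales (auto simp: irreducible_pip_def intro: le_trans)

text \<open>Inconsistency and CC1 are read off from common upper bounds, and Regularity is
  \<open>irreducible_le_join\<close>. The triple join condition enters in the Weak Triangle axiom
  and in CC2.\<close>

lemma PPIP_irreducible_pip: "PPIP (irreducible_pip L)"
proof -
  interpret Q: partial_order "irreducible_pip L" by (rule partial_order_irreducible_pip)
  show ?thesis
  proof (unfold_locales, unfold carrier_irreducible_pip le_irreducible_pip incon_irreducible_pip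
      incomparable_irreducible_pip)
    fix p q assume "p \<in> J" "q \<in> J" "\<not> has_join L {p, q}"
    then show "\<not> has_join L {q, p}" by (simp add: insert_commute)
  next
    fix p q assume "p \<in> J" "q \<in> J" "\<not> has_join L {p, q}"
    then show "\<not> (\<exists>u\<in>J. p \<sqsubseteq> u \<and> q \<sqsubseteq> u)" using has_join_iff_bounded by blast
  next
    fix p q p' q' assume *: "p \<in> J" "q \<in> J" "p' \<in> J" "q' \<in> J" "\<not> has_join L {p, q}" "p \<sqsubseteq> p'" "q \<sqsubseteq> q'"
    show "\<not> has_join L {p', q'}"
    proof
      assume "has_join L {p', q'}"
      then obtain u where u: "u \<in> carrier L" "p' \<sqsubseteq> u" "q' \<sqsubseteq> u"
        using * has_join_iff_bounded by blast
      then have "p \<sqsubseteq> u" "q \<sqsubseteq> u" using * le_trans[of p p' u] le_trans[of q q' u] by blast+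
      then show False using * u has_join_iff_bounded[of p q] by blast
    qed
  next
    fix p q r assume "col\<^bsub>irreducible_pip L\<^esub> p q r"
    then show "col\<^bsub>irreducible_pip L\<^esub> q p r \<and> col\<^bsub>irreducible_pip L\<^esub> q r p"
      using collinear_perm by blast
  next
    fix p q r assume "col\<^bsub>irreducible_pip L\<^esub> p q r"
    then show "incomparable L p q \<and> incomparable L q r \<and> incomparable L p r"
      using collinear_incomparable by blast
  next
    fix p q r w assume *: "p \<in> J" "q \<in> J" "r \<in> J" "w \<in> J" "col\<^bsub>irreducible_pip L\<^esub> p q r" "p \<sqsubseteq> w" "q \<sqsubseteq> w"
    then show "r \<sqsubseteq> w" using collinear_least[of p q r w] by blast
  next
    fix p q r r' assume *: "p \<in> J" "q \<in> J" "r \<in> J" "r' \<in> J" "col\<^bsub>irreducible_pip L\<^esub> p q r"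
      "r' \<sqsubseteq> r" "\<not> r' \<sqsubseteq> p" "\<not> r' \<sqsubseteq> q"
    then obtain s where s: "s \<in> carrier L" "least L s (Upper L {p, q})" "r \<sqsubseteq> s"
      using collinearD[of p q r] by blast
    then have r's: "r' \<sqsubseteq> s" using * le_trans[of r' r s] by blast
    show "\<exists>p'\<in>J. \<exists>q'\<in>J. p' \<sqsubseteq> p \<and> q' \<sqsubseteq> q \<and> col\<^bsub>irreducible_pip L\<^esub> p' q' r'"
      by (rule irreducible_le_join[of r' p q s]) (use * s r's in auto)
  next
    fix a b c p q assume *: "a \<in> J" "b \<in> J" "c \<in> J" "p \<in> J" "q \<in> J"
      and col: "col\<^bsub>irreducible_pip L\<^esub> a c p" "col\<^bsub>irreducible_pip L\<^esub> b c q"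
      and con: "consistent (irreducible_pip L) {a, b, c, p, q}"
    have "has_join L {x, y}" if "x \<in> {a, b, c, p, q}" "y \<in> {a, b, c, p, q}" for x y
      using con that unfolding consistent_def incon_irreducible_pip by blast
    \<comment> \<open>The triple join condition bounds \<open>a\<close>, \<open>b\<close>,
      \<open>c\<close> by one \<open>u\<close>, which then also bounds \<open>p\<close> and
      \<open>q\<close>; the whole configuration moves into the modular lattice below
      \<open>u\<close>.\<close>
    then have "has_join L {a, b}" "has_join L {b, c}" "has_join L {c, a}" by blast+
    then obtain u where u: "u \<in> carrier L" "a \<sqsubseteq> u" "b \<sqsubseteq> u" "c \<sqsubseteq> u"
      using * has_join_triple[of a b c] by blast
    have "p \<sqsubseteq> u"
      using collinear_least[OF col(1)] u * by auto
    have "q \<sqsubseteq> u"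
      using collinear_least[OF col(2)] u * by auto
    show "(\<exists>x\<in>J. triangle_configuration (irreducible_pip L) a b c p q x)
          \<or> (\<exists>a'\<in>J. a' \<sqsubseteq> a \<and> col\<^bsub>irreducible_pip L\<^esub> b q a')
          \<or> col\<^bsub>irreducible_pip L\<^esub> b q p
          \<or> (\<exists>a'\<in>J. \<exists>p'\<in>J. a' \<sqsubseteq> a \<and> p' \<sqsubseteq> p \<and> col\<^bsub>irreducible_pip L\<^esub> q a' p')
          \<or> q \<sqsubseteq> a \<or> q \<sqsubseteq> p"
    proof -
      interpret I: finite_length_modular_lattice "principal_ideal L u"
        by (rule finite_length_modular_lattice_ideal[OF u(1)])
      note le = u(2-4) \<open>p \<sqsubseteq> u\<close> \<open>q \<sqsubseteq> u\<close>
      have colI: "I.C x y z \<longleftrightarrow> col\<^bsub>irreducible_pip L\<^esub> x y z"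
        if "x \<in> J" "y \<in> J" "z \<in> J" "x \<sqsubseteq> u" "y \<sqsubseteq> u" "z \<sqsubseteq> u" for x y z
        using that u(1) by (intro collinear_ideal) auto
      have conf: "triangle_configuration (irreducible_pip (principal_ideal L u)) a b c p q x \<longleftrightarrow>
          triangle_configuration (irreducible_pip L) a b c p q x" if "x \<in> J" "x \<sqsubseteq> u" for x
      proof -
        have "{a, b, c, p, q, x} \<subseteq> {y \<in> J. y \<sqsubseteq> u}" using * le that by simp
        then have "I.C y z w \<longleftrightarrow> col\<^bsub>irreducible_pip L\<^esub> y z w"
          if "y \<in> {a, b, c, p, q, x}" "z \<in> {a, b, c, p, q, x}" "w \<in> {a, b, c, p, q, x}" for y z w
          using that by (intro colI) blast+
        then show ?thesis
          unfolding triangle_configuration_def incomparable_irreducible_pip incomparable_ideal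
          by auto
      qed
      have below: "x \<sqsubseteq> u" if "x \<sqsubseteq> y" "y \<sqsubseteq> u" "x \<in> J" "y \<in> J" for x y
        using that u(1) le_trans[of x y u] by blast
      have IJ: "x \<in> I.J \<longleftrightarrow> x \<in> J \<and> x \<sqsubseteq> u" for x
        using join_irreducibles_ideal[OF u(1)] by simp
      have "I.C a c p" "I.C b c q" using colI * col le by simp_all
      moreover have "a \<in> I.J" "b \<in> I.J" "c \<in> I.J" "p \<in> I.J" "q \<in> I.J" using IJ * le by simp_all
      ultimately have "(\<exists>x\<in>I.J. triangle_configuration (irreducible_pip (principal_ideal L u)) a b c p q x)
          \<or> (\<exists>a'\<in>I.J. a' \<sqsubseteq> a \<and> I.C b q a') \<or> I.C b q p
          \<or> (\<exists>a'\<in>I.J. \<exists>p'\<in>I.J. a' \<sqsubseteq> a \<and> p' \<sqsubseteq> p \<and> I.C q a' p') \<or> q \<sqsubseteq> a \<or> q \<sqsubseteq> p"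
        using I.irreducible_weak_triangle[of a b c p q] by simp
      then consider
          x where "x \<in> I.J" "triangle_configuration (irreducible_pip (principal_ideal L u)) a b c p q x"
        | a' where "a' \<in> I.J" "a' \<sqsubseteq> a" "I.C b q a'" | "I.C b q p"
        | a' p' where "a' \<in> I.J" "p' \<in> I.J" "a' \<sqsubseteq> a" "p' \<sqsubseteq> p" "I.C q a' p'"
        | "q \<sqsubseteq> a \<or> q \<sqsubseteq> p"
        by blast
      then show ?thesis
      proof cases
        case (1 x)
        then have "x \<in> J" "triangle_configuration (irreducible_pip L) a b c p q x"
          using conf[of x] IJ[of x] by simp_all
        then show ?thesis by blast
      next
        case (2 a')
        then have "a' \<in> J" "col\<^bsub>irreducible_pip L\<^esub> b q a'"
          using colI[of b q a'] IJ[of a'] * le by simp_all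
        then show ?thesis using 2 by blast
      next
        case 3
        then have "col\<^bsub>irreducible_pip L\<^esub> b q p" using colI[of b q p] * le by simp
        then show ?thesis by blast
      next
        case (4 a' p')
        then have "a' \<in> J" "p' \<in> J" "col\<^bsub>irreducible_pip L\<^esub> q a' p'"
          using colI[of q a' p'] IJ[of a'] IJ[of p'] * le by simp_all
        then show ?thesis using 4 by blast
      qed blast
    qed
  next
    fix p q r assume *: "p \<in> J" "q \<in> J" "r \<in> J" "col\<^bsub>irreducible_pip L\<^esub> p q r"
    then obtain s where s: "s \<in> carrier L" "p \<sqsubseteq> s" "q \<sqsubseteq> s" "r \<sqsubseteq> s"
      using collinearD[of p q r] by blast
    have "has_join L {x, y}" if "x \<in> {p, q, r}" "y \<in> {p, q, r}" for x y
    proof -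
      have "x \<in> carrier L" "y \<in> carrier L" "x \<sqsubseteq> s" "y \<sqsubseteq> s" using that * s by auto
      then show ?thesis using s(1) has_join_iff_bounded by blast
    qed
    then show "consistent (irreducible_pip L) {p, q, r}"
      unfolding consistent_def incon_irreducible_pip by blast
  next
    fix p q r x assume *: "p \<in> J" "q \<in> J" "r \<in> J" "x \<in> J" and col: "col\<^bsub>irreducible_pip L\<^esub> p q r"
    \<comment> \<open>Core of CC2: if \<open>x\<close> is compatible with two points of a line, the
      triple join bounds all three, and this bound lies above the third point of the line as
      well.\<close>
    have all: "has_join L {x, w}"
      if h: "has_join L {x, u}" "has_join L {x, v}" "col\<^bsub>irreducible_pip L\<^esub> u v w" "u \<in> J" "v \<in> J" "w \<in> J"
      for u v w
    proof -
      obtain s where "least L s (Upper L {u, v})"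
        by (rule collinearD[of u v w]) (use h in auto)
      then have "has_join L {u, v}" by (auto simp: has_join_def)
      then obtain t where t: "t \<in> carrier L" "x \<sqsubseteq> t" "u \<sqsubseteq> t" "v \<sqsubseteq> t"
        using has_join_triple[of x u v] h * by (auto simp: insert_commute)
      have "w \<sqsubseteq> t" using collinear_least[of u v w t] t h by blast
      then show ?thesis using t h * has_join_iff_bounded[of x w] by blast
    qed
    have ne: "p \<noteq> q" "q \<noteq> r" "p \<noteq> r"
      using collinear_incomparable[OF col] * by (auto simp: incomparable_def)
    have cols: "col\<^bsub>irreducible_pip L\<^esub> q r p" "col\<^bsub>irreducible_pip L\<^esub> r p q"
      using col collinear_perm by blast+
    show "card {s \<in> {p, q, r}. \<not> \<not> has_join L {x, s}} \<le> 1 \<or> (\<forall>s\<in>{p, q, r}. \<not> \<not> has_join L {x, s})"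
    proof (rule disjCI)
      assume "\<not> (\<forall>s\<in>{p, q, r}. \<not> \<not> has_join L {x, s})"
      then obtain t where "{s \<in> {p, q, r}. \<not> \<not> has_join L {x, s}} \<subseteq> {t}"
        using all[OF _ _ col] all[OF _ _ cols(1)] all[OF _ _ cols(2)] * by blast
      then show "card {s \<in> {p, q, r}. \<not> \<not> has_join L {x, s}} \<le> 1"
        using card_mono[of "{t}"] by simp
    qed
  qed
qed

section \<open>Joins of consistent subspaces and the maps \<open>phi\<close> and
  \<open>psi\<close>\<close>

lemma bottom_exists:
  obtains b where "least L b (carrier L)"
proof -
  obtain x where "x \<in> carrier L" using nonempty by blast
  then obtain m where m: "m \<in> carrier L" "\<And>y. y \<in> carrier L \<Longrightarrow> y \<sqsubseteq> m \<Longrightarrow> y = m"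
    using minimal_element[OF finite_length, of "carrier L" x] by blast
  have "m \<sqsubseteq> y" if "y \<in> carrier L" for y
    using m(2)[of "m \<sqinter> y"] meet_left[of m y] meet_right[of m y] m(1) that by simp
  then show thesis using that[of m] m(1) by (auto simp: least_def)
qed

lemma least_Upper_insert:
  assumes "F \<subseteq> carrier L" "f \<in> carrier L" "least L s (Upper L F)"
  shows "Upper L {f, s} = Upper L (insert f F)"
proof -
  have F: "x \<in> carrier L" if "x \<in> F" for x using assms(1) that by blast
  have s: "s \<in> carrier L" using assms(3) by simp
  have above: "x \<sqsubseteq> s" if "x \<in> F" for x by (rule least_Upper_above[OF assms(3) that assms(1)])
  have "s \<sqsubseteq> u \<longleftrightarrow> (\<forall>x\<in>F. x \<sqsubseteq> u)" if "u \<in> carrier L" for u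
  proof
    assume "s \<sqsubseteq> u"
    then show "\<forall>x\<in>F. x \<sqsubseteq> u" using le_trans[OF above] F s that by blast
  next
    assume "\<forall>x\<in>F. x \<sqsubseteq> u"
    then show "s \<sqsubseteq> u" using that by (intro least_le[OF assms(3)] Upper_memI) auto
  qed
  then show ?thesis
    using F s assms(2) unfolding Upper_def by auto
qed

text \<open>Iterates the triple join condition. The second conclusion carries the induction: it
  supplies compatibility of the join so far with the next element.\<close>

lemma finite_pairwise_join:
  assumes "finite F" "F \<subseteq> carrier L" "\<And>x y. x \<in> F \<Longrightarrow> y \<in> F \<Longrightarrow> has_join L {x, y}"
  obtains s where "least L s (Upper L F)"
    "\<And>z. z \<in> carrier L \<Longrightarrow> (\<And>x. x \<in> F \<Longrightarrow> has_join L {x, z}) \<Longrightarrow> has_join L {s, z}"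
proof -
  have "\<exists>s. least L s (Upper L F) \<and>
      (\<forall>z\<in>carrier L. (\<forall>x\<in>F. has_join L {x, z}) \<longrightarrow> has_join L {s, z})"
    using assms
  proof (induction F rule: finite_induct)
    case empty
    obtain b where b: "least L b (carrier L)" by (rule bottom_exists)
    then have "has_join L {b, z}" if "z \<in> carrier L" for z
      using has_join_iff_bounded[of b z] that by (auto simp: least_def)
    then show ?case using b by auto
  next
    case (insert f F)
    then obtain s where s: "least L s (Upper L F)"
      "\<And>z. z \<in> carrier L \<Longrightarrow> \<forall>x\<in>F. has_join L {x, z} \<Longrightarrow> has_join L {s, z}"
      by auto
    have cl: "f \<in> carrier L" "s \<in> carrier L" "F \<subseteq> carrier L" using insert.prems s by auto
    have fs: "has_join L {f, s}"
      using s(2)[OF cl(1)] insert.prems(2) by (simp add: insert_commute)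
    then obtain t where t: "least L t (Upper L {f, s})" by (auto simp: has_join_def)
    have "has_join L {t, z}" if z: "z \<in> carrier L" "\<forall>x\<in>insert f F. has_join L {x, z}" for z
    proof -
      have "has_join L {s, z}" "has_join L {z, f}" using s(2)[of z] z by (auto simp: insert_commute[of z f])
      then obtain u where u: "u \<in> carrier L" "f \<sqsubseteq> u" "s \<sqsubseteq> u" "z \<sqsubseteq> u"
        using has_join_triple[of f s z] fs cl z by blast
      have "t \<sqsubseteq> u" using u cl by (intro least_le[OF t] Upper_memI) auto
      then show ?thesis using u z(1) least_closed[OF t] has_join_iff_bounded[of t z] by blast
    qed
    then show ?case
      using t least_Upper_insert[OF cl(3,1) s(1)] by auto
  qed
  then show thesis using that by blast
qed

text \<open>\<open>I\<close> may be infinite, but its finite subsets have joins. By finite length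
  one of these joins is maximal, and it bounds all of \<open>I\<close>.\<close>

lemma consistent_subspace_sup:
  assumes I: "subspace (irreducible_pip L) I" "consistent (irreducible_pip L) I"
  obtains s where "least L s (Upper L I)" "phi L s = I"
proof -
  have IJ: "I \<subseteq> J" using I(1) by (simp add: subspace_def)
  have IC: "I \<subseteq> carrier L" using IJ by blast
  have down: "y \<in> I" if "x \<in> I" "y \<in> J" "y \<sqsubseteq> x" for x y
    using I(1) that unfolding subspace_def carrier_irreducible_pip le_irreducible_pip by blast
  have line: "r \<in> I" if "p \<in> I" "q \<in> I" "r \<in> J" "col\<^bsub>irreducible_pip L\<^esub> p q r" for p q r
    using I(1) that unfolding subspace_def carrier_irreducible_pip le_irreducible_pip by blast
  have hj: "has_join L {x, y}" if "x \<in> I" "y \<in> I" for x y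
    using I(2) that unfolding consistent_def incon_irreducible_pip by blast
  \<comment> \<open>Induction on \<open>F\<close>: an irreducible below the join of \<open>f\<close>
    and the rest lies below one of them, or on a line through a point below each. Downward closure
    and closure under lines keep it in \<open>I\<close>.\<close>
  have closed: "p \<in> I"
    if "finite F" "F \<subseteq> I" "least L s (Upper L F)" "p \<in> J" "p \<sqsubseteq> s" for F s p
    using that
  proof (induction F arbitrary: s p rule: finite_induct)
    case empty
    \<comment> \<open>The empty set has the minimum as its join, and an irreducible element is never
      the minimum.\<close>
    then have "least L p (carrier L)"
      using le_trans[of p s] by (auto simp: least_def)
    then show ?case using empty by (simp add: join_irreducibles_def del: J_closed)
  next
    case (insert f F)
    then have F: "F \<subseteq> I" "F \<subseteq> carrier L" "f \<in> I" "f \<in> carrier L" using IC by auto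
    obtain t where t: "least L t (Upper L F)"
      by (rule finite_pairwise_join[OF insert.hyps(1) F(2)]) (use hj F(1) in blast)+
    have s: "least L s (Upper L {f, t})"
      using insert.prems(2) least_Upper_insert[OF F(2,4) t] by simp
    show ?case
    proof (cases "p \<sqsubseteq> f \<or> p \<sqsubseteq> t")
      case True
      then show ?thesis
        using insert.IH[OF F(1) t insert.prems(3)] down[OF F(3) insert.prems(3)] by blast
    next
      case False
      then have "\<not> p \<sqsubseteq> f" "\<not> p \<sqsubseteq> t" by blast+
      from irreducible_le_join[OF insert.prems(3) F(4) least_closed[OF t] s insert.prems(4) this]
      obtain x y where xy: "x \<in> J" "y \<in> J" "x \<sqsubseteq> f" "y \<sqsubseteq> t" "col\<^bsub>irreducible_pip L\<^esub> x y p" .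
      then have "x \<in> I" "y \<in> I"
        using insert.IH[OF F(1) t, of y] down[OF F(3), of x] by blast+
      then show ?thesis using line xy(5) insert.prems(3) by blast
    qed
  qed
  let ?S = "{s. \<exists>F. finite F \<and> F \<subseteq> I \<and> least L s (Upper L F)}"
  obtain b where "least L b (carrier L)" by (rule bottom_exists)
  then have b: "b \<in> ?S" by (auto intro!: exI[of _ "{}"])
  have "?S \<subseteq> carrier L" by auto
  then obtain s where s: "s \<in> ?S" and max: "\<And>t. t \<in> ?S \<Longrightarrow> s \<sqsubseteq> t \<Longrightarrow> t = s"
    by (rule maximal_element[OF finite_length _ b]) iprover
  from s obtain F where F: "finite F" "F \<subseteq> I" "least L s (Upper L F)" by blast
  have sC: "s \<in> carrier L" using F by simp
  have upper: "i \<sqsubseteq> s" if "i \<in> I" for i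
  proof -
    have "insert i F \<subseteq> carrier L" "finite (insert i F)" "insert i F \<subseteq> I" using F that IC by auto
    moreover from this obtain t where t: "least L t (Upper L (insert i F))"
      using finite_pairwise_join hj by (metis subsetD)
    ultimately have "t \<in> ?S" by blast
    \<comment> \<open>Adding \<open>i\<close> to \<open>F\<close> can only enlarge the join, so
      maximality of \<open>s\<close> gives \<open>t = s\<close> and hence
      \<open>i \<sqsubseteq> s\<close>.\<close>
    moreover have "s \<sqsubseteq> t"
      using Upper_antimono[of F "insert i F" L] t by (intro least_le[OF F(3)]) (auto simp: least_def)
    ultimately have "t = s" by (rule max)
    then show ?thesis using least_Upper_above[OF t] \<open>insert i F \<subseteq> carrier L\<close> by auto
  qed
  have "least L s (Upper L I)"
    using upper IC sC Upper_antimono[OF F(2), of L] least_le[OF F(3)] by (intro least_UpperI) auto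
  moreover have "phi L s = I"
    using closed[OF F] upper IJ by (auto simp: phi_def)
  ultimately show thesis by (rule that)
qed

lemma phi_consistent_subspace:
  assumes l: "l \<in> carrier L"
  shows "subspace (irreducible_pip L) (phi L l)" "consistent (irreducible_pip L) (phi L l)"
proof -
  show "subspace (irreducible_pip L) (phi L l)"
    unfolding subspace_def phi_def carrier_irreducible_pip le_irreducible_pip
    using l le_trans[of _ _ l] collinear_least[of _ _ _ l] by auto
  show "consistent (irreducible_pip L) (phi L l)"
    unfolding consistent_def phi_def incon_irreducible_pip using has_join_iff_bounded l by blast
qed

text \<open>Reflection of the order is the join-density of the irreducibles.\<close>

lemma phi_le_iff:
  assumes "l \<in> carrier L" "m \<in> carrier L"
  shows "phi L l \<subseteq> phi L m \<longleftrightarrow> l \<sqsubseteq> m"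
proof
  assume "phi L l \<subseteq> phi L m"
  then have "p \<sqsubseteq> m" if "p \<in> J" "p \<sqsubseteq> l" for p using that by (auto simp: phi_def)
  then show "l \<sqsubseteq> m" by (meson irreducible_below[OF assms])
next
  assume "l \<sqsubseteq> m"
  then show "phi L l \<subseteq> phi L m" using assms le_trans[of _ l m] by (auto simp: phi_def)
qed

text \<open>The two branches of \<open>psi\<close> agree, since \<open>\<bottom>\<close> and
  \<open>\<Squnion>{}\<close> select a least element of the same set. Empty subspaces thus need no
  separate treatment.\<close>

lemma psi_eqI:
  assumes "least L s (Upper L I)"
  shows "psi L I = s"
proof -
  have "\<bottom> = \<Squnion>{}" by (simp add: bottom_def sup_def)
  then show ?thesis using sup_eqI[OF assms] by (auto simp: psi_def)
qed

lemma psi_consistent_subspace: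
  assumes "I \<in> carrier (consistent_subspaces (irreducible_pip L))"
  shows "least L (psi L I) (Upper L I)" "phi L (psi L I) = I"
proof -
  obtain s where "least L s (Upper L I)" "phi L s = I"
    using assms consistent_subspace_sup[of I] by auto
  then show "least L (psi L I) (Upper L I)" "phi L (psi L I) = I" using psi_eqI by auto
qed

lemma order_iso_phi: "order_iso L (consistent_subspaces (irreducible_pip L)) (phi L)"
proof -
  let ?C = "consistent_subspaces (irreducible_pip L)"
  have maps: "phi L l \<in> carrier ?C" if "l \<in> carrier L" for l
    using phi_consistent_subspace[OF that] by simp
  interpret C: partial_order ?C by (rule partial_order_consistent_subspaces)
  have "order_emb L ?C (phi L)"
    unfolding order_emb_def le_consistent_subspaces
    using phi_le_iff C.weak_partial_order_axioms weak_partial_order_axioms by blast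
  moreover have "inj_on (phi L) (carrier L)"
    using phi_le_iff le_antisym by (metis inj_onI subset_refl)
  moreover have "I \<in> phi L ` carrier L" if "I \<in> carrier ?C" for I
    using psi_consistent_subspace[OF that] by (metis imageI least_closed)
  ultimately show ?thesis
    using maps unfolding order_iso_def bij_betw_def by blast
qed

lemma psi_phi:
  assumes l: "l \<in> carrier L"
  shows "psi L (phi L l) = l"
proof -
  have C: "phi L l \<in> carrier (consistent_subspaces (irreducible_pip L))"
    using phi_consistent_subspace[OF l] by simp
  then have "psi L (phi L l) \<in> carrier L" using psi_consistent_subspace(1) by blast
  then show ?thesis
    using psi_consistent_subspace(2)[OF C] phi_le_iff l by (metis le_antisym subset_refl)
qed

lemma finite_length_irreducible_pip: "finite_length (irreducible_pip L)"
  by (rule finite_length_mono[OF finite_length]) auto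

end


section \<open>The semilattice of consistent subspaces\<close>

context PPIP
begin

lemma incon_irrefl: "p \<in> carrier P \<Longrightarrow> \<not> p \<smile> p"
  using IC1[of p p] by auto

lemma col_swap: "\<lbrakk>p \<in> carrier P; q \<in> carrier P; r \<in> carrier P; col p q r\<rbrakk> \<Longrightarrow> col q p r"
  and col_rotate: "\<lbrakk>p \<in> carrier P; q \<in> carrier P; r \<in> carrier P; col p q r\<rbrakk> \<Longrightarrow> col q r p"
  using col_perm by blast+

lemma col_not_le:
  assumes "p \<in> carrier P" "q \<in> carrier P" "r \<in> carrier P" "col p q r"
  shows "\<not> p \<sqsubseteq> q" "\<not> q \<sqsubseteq> p" "\<not> p \<sqsubseteq> r" "\<not> r \<sqsubseteq> p" "\<not> q \<sqsubseteq> r" "\<not> r \<sqsubseteq> q"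
  using CT1[OF assms] by (simp_all add: incomparable_def)

section \<open>Line sums of ideals\<close>

definition ideal :: "'a set \<Rightarrow> bool" where
  "ideal X \<longleftrightarrow> X \<subseteq> carrier P \<and> (\<forall>x\<in>X. \<forall>y\<in>carrier P. y \<sqsubseteq> x \<longrightarrow> y \<in> X)"

definition line_sum :: "'a set \<Rightarrow> 'a set \<Rightarrow> 'a set" where
  "line_sum X Y = X \<union> Y \<union> {z \<in> carrier P. \<exists>x\<in>X. \<exists>y\<in>Y. col x y z}"

lemma ideal_closed: "\<lbrakk>ideal X; x \<in> X\<rbrakk> \<Longrightarrow> x \<in> carrier P"
  and ideal_down: "\<lbrakk>ideal X; x \<in> X; y \<in> carrier P; y \<sqsubseteq> x\<rbrakk> \<Longrightarrow> y \<in> X"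
  by (auto simp: ideal_def)

lemma subspace_iff: "subspace P X \<longleftrightarrow> ideal X \<and> (\<forall>p\<in>X. \<forall>q\<in>X. \<forall>r\<in>carrier P. col p q r \<longrightarrow> r \<in> X)"
  by (auto simp: subspace_def ideal_def)

lemma subspace_ideal: "subspace P X \<Longrightarrow> ideal X"
  and subspace_line: "\<lbrakk>subspace P X; p \<in> X; q \<in> X; r \<in> carrier P; col p q r\<rbrakk> \<Longrightarrow> r \<in> X"
  unfolding subspace_iff by blast+

lemma subspace_subset: "subspace P X \<Longrightarrow> X \<subseteq> carrier P"
  unfolding subspace_def by blast

lemma consistent_mono: "\<lbrakk>consistent P Y; X \<subseteq> Y\<rbrakk> \<Longrightarrow> consistent P X"
  by (auto simp: consistent_def)

lemma line_sumE:
  assumes "z \<in> line_sum X Y"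
  obtains "z \<in> X" | "z \<in> Y" | x y where "z \<in> carrier P" "x \<in> X" "y \<in> Y" "col x y z"
  using assms by (auto simp: line_sum_def)

lemma line_sum_left: "z \<in> X \<Longrightarrow> z \<in> line_sum X Y"
  and line_sum_right: "z \<in> Y \<Longrightarrow> z \<in> line_sum X Y"
  and line_sum_line: "\<lbrakk>x \<in> X; y \<in> Y; z \<in> carrier P; col x y z\<rbrakk> \<Longrightarrow> z \<in> line_sum X Y"
  by (auto simp: line_sum_def)

lemma line_sum_mono: "\<lbrakk>X \<subseteq> X'; Y \<subseteq> Y'\<rbrakk> \<Longrightarrow> line_sum X Y \<subseteq> line_sum X' Y'"
  by (auto simp: line_sum_def)

lemma line_sum_comm:
  assumes "ideal X" "ideal Y"
  shows "line_sum X Y = line_sum Y X"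
proof -
  have "line_sum A B \<subseteq> line_sum B A" if "ideal A" "ideal B" for A B
  proof
    fix z assume "z \<in> line_sum A B"
    then show "z \<in> line_sum B A"
    proof (cases rule: line_sumE)
      case (3 x y)
      then have "col y x z" using col_swap ideal_closed[OF that(1)] ideal_closed[OF that(2)] by blast
      then show ?thesis using 3 line_sum_line by blast
    qed (auto simp: line_sum_def)
  qed
  then show ?thesis using assms by blast
qed

lemma line_sum_subset:
  assumes "subspace P S" "X \<subseteq> S" "Y \<subseteq> S"
  shows "line_sum X Y \<subseteq> S"
proof
  fix z assume "z \<in> line_sum X Y"
  then show "z \<in> S"
    by (cases rule: line_sumE) (use assms(2,3) subspace_line[OF assms(1)] in blast)+
qed

text \<open>Regularity provides the downward closure for points on a line between \<open>X\<close>
  and \<open>Y\<close>.\<close>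

lemma ideal_line_sum:
  assumes X: "ideal X" and Y: "ideal Y"
  shows "ideal (line_sum X Y)"
proof -
  have "y \<in> line_sum X Y" if z: "z \<in> line_sum X Y" and y: "y \<in> carrier P" "y \<sqsubseteq> z" for y z
    using z
  proof (cases rule: line_sumE)
    case 1
    then show ?thesis using ideal_down[OF X] y line_sum_left by blast
  next
    case 2
    then show ?thesis using ideal_down[OF Y] y line_sum_right by blast
  next
    case (3 u v)
    have cl: "u \<in> carrier P" "v \<in> carrier P" using 3 X Y ideal_closed by blast+
    show ?thesis
    proof (cases "y \<sqsubseteq> u \<or> y \<sqsubseteq> v")
      case True
      then show ?thesis
        using ideal_down[OF X 3(2) y(1)] ideal_down[OF Y 3(3) y(1)] line_sum_left line_sum_right by blast
    next
      case False
      then obtain u' v' where "u' \<in> carrier P" "v' \<in> carrier P" "u' \<sqsubseteq> u" "v' \<sqsubseteq> v" "col u' v' y"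
        using regularity[OF cl 3(1) y(1) 3(4) y(2)] by blast
      then show ?thesis
        using ideal_down[OF X 3(2)] ideal_down[OF Y 3(3)] line_sum_line y(1) by blast
    qed
  qed
  moreover have "line_sum X Y \<subseteq> carrier P"
    using X Y by (auto simp: line_sum_def ideal_def)
  ultimately show ?thesis unfolding ideal_def by blast
qed

text \<open>The Weak Triangle axiom is exactly what is needed for associativity: with \<open>c\<close> the point of
  \<open>X + Y\<close> on the line through \<open>p \<in> X\<close> and \<open>a \<in> Y\<close>, and \<open>q\<close> on the line through \<open>c\<close> and \<open>b \<in> Z\<close>,
  each of its alternatives exhibits \<open>q\<close> as a member of \<open>X + (Y + Z)\<close>.\<close>

lemma line_sum_assoc:
  assumes X: "ideal X" and Y: "ideal Y" and Z: "ideal Z"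
    and S: "subspace P S" "consistent P S" "X \<subseteq> S" "Y \<subseteq> S" "Z \<subseteq> S"
  shows "line_sum (line_sum X Y) Z \<subseteq> line_sum X (line_sum Y Z)"
proof
  fix q assume "q \<in> line_sum (line_sum X Y) Z"
  then show "q \<in> line_sum X (line_sum Y Z)"
  proof (cases rule: line_sumE)
    case 1
    then show ?thesis
      using line_sum_mono[of X X Y "line_sum Y Z"] line_sum_left by blast
  next
    case 2
    then show ?thesis by (intro line_sum_right[of q "line_sum Y Z"] line_sum_right[of q Z])
  next
    case (3 c b)
    note q = 3(1) and b = 3(3) and cbq = 3(4)
    have bC: "b \<in> carrier P" using b Z ideal_closed by blast
    from 3(2) show ?thesis
    proof (cases rule: line_sumE)
      case 1
      then show ?thesis using line_sum_line[OF 1 line_sum_right[OF b] q cbq] by blast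
    next
      case 2
      then show ?thesis by (intro line_sum_right[OF line_sum_line[OF _ b q cbq]])
    next
      case (3 p a)
      note c = 3(1) and p = 3(2) and a = 3(3) and pac = 3(4)
      have C: "p \<in> carrier P" "a \<in> carrier P" using p a X Y ideal_closed by blast+
      have acp: "col a c p" using col_rotate[OF C c pac] .
      have bcq: "col b c q" using col_swap[OF c bC q cbq] .
      have "c \<in> S" using subspace_line[OF S(1) _ _ c pac] p a S by blast
      moreover from this have "q \<in> S" using subspace_line[OF S(1) _ _ q cbq] b S by blast
      ultimately have "consistent P {a, b, c, p, q}"
        using p a b S by (intro consistent_mono[OF S(2)]) auto
      from weak_triangle[OF C(2) bC c C(1) q acp bcq this]
      consider x where "x \<in> carrier P" "triangle_configuration P a b c p q x"
        | a' where "a' \<in> carrier P" "a' \<sqsubseteq> a" "col b q a'" | "col b q p"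
        | a' p' where "a' \<in> carrier P" "p' \<in> carrier P" "a' \<sqsubseteq> a" "p' \<sqsubseteq> p" "col q a' p'"
        | "q \<sqsubseteq> a" | "q \<sqsubseteq> p"
        by blast
      then show ?thesis
      proof cases
        case (1 x)
        \<comment> \<open>The sixth point of the triangle lies in \<open>Y + Z\<close>, and
          \<open>q\<close> is on the line joining it to \<open>p\<close>.\<close>
        then have "col a b x" "col p q x" by (simp_all add: triangle_configuration_def)
        moreover from this have "col p x q"
          by (intro col_swap[OF 1(1) C(1) q] col_rotate[OF q 1(1) C(1)] col_rotate[OF C(1) q 1(1)])
        ultimately have "x \<in> line_sum Y Z" "col p x q" using line_sum_line[OF a b] 1(1) by blast+
        then show ?thesis by (intro line_sum_line[OF p _ q])
      next
        case (2 a')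
        then have "a' \<in> Y" using ideal_down[OF Y a] by blast
        moreover have "col a' b q" using col_rotate[OF q 2(1) bC] col_rotate[OF bC q 2(1) 2(3)] by blast
        ultimately show ?thesis using line_sum_line[OF _ b q] line_sum_right by blast
      next
        case 3
        then have "col p b q" using col_rotate[OF q C(1) bC] col_rotate[OF bC q C(1)] by blast
        then show ?thesis using line_sum_line[OF p line_sum_right[OF b] q] by blast
      next
        case (4 a' p')
        then have "a' \<in> Y" "p' \<in> X" using ideal_down[OF Y a] ideal_down[OF X p] by blast+
        moreover have "col p' a' q"
          using col_rotate[OF q 4(1,2,5)] col_swap[OF 4(1,2) q] by blast
        ultimately show ?thesis using line_sum_line[OF _ line_sum_left q] by blast
      next
        case 5
        then have "q \<in> Y" using ideal_down[OF Y a q] by blast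
        then show ?thesis by (intro line_sum_right[of q "line_sum Y Z"] line_sum_left)
      next
        case 6
        then have "q \<in> X" using ideal_down[OF X p q] by blast
        then show ?thesis by (rule line_sum_left)
      qed
    qed
  qed
qed

text \<open>Associativity and commutativity collapse \<open>(X + Y) + (X + Y)\<close> to
  \<open>X + Y\<close>. The consistent subspace \<open>S\<close> provides the consistency that
  associativity requires.\<close>

lemma subspace_line_sum:
  assumes X: "subspace P X" and Y: "subspace P Y"
    and S: "subspace P S" "consistent P S" "X \<subseteq> S" "Y \<subseteq> S"
  shows "subspace P (line_sum X Y)"
proof -
  let ?W = "line_sum X Y"
  note iX = subspace_ideal[OF X] and iY = subspace_ideal[OF Y]
  note iW = ideal_line_sum[OF iX iY]
  have WS: "?W \<subseteq> S" by (rule line_sum_subset[OF S(1,3,4)])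
  have idem: "line_sum A A \<subseteq> A" if "subspace P A" for A
    by (rule line_sum_subset[OF that]) simp_all
  \<comment> \<open>\<open>B + (A + B) = (A + B) + B\<close>, which associativity places inside
    \<open>A + (B + B)\<close>; a subspace contains its sum with itself.\<close>
  have absorb: "line_sum B (line_sum A B) \<subseteq> line_sum A B"
    if "subspace P A" "subspace P B" "A \<subseteq> S" "B \<subseteq> S" for A B
  proof -
    note iA = subspace_ideal[OF that(1)] and iB = subspace_ideal[OF that(2)]
    have "line_sum B (line_sum A B) = line_sum (line_sum A B) B"
      by (rule line_sum_comm[OF iB ideal_line_sum[OF iA iB]])
    also have "\<dots> \<subseteq> line_sum A (line_sum B B)"
      by (rule line_sum_assoc[OF iA iB iB S(1,2) that(3,4,4)])
    also have "\<dots> \<subseteq> line_sum A B"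
      by (rule line_sum_mono) (simp_all add: idem that)
    finally show ?thesis .
  qed
  have "line_sum ?W ?W \<subseteq> line_sum X (line_sum Y ?W)"
    by (rule line_sum_assoc[OF iX iY iW S(1-4) WS])
  also have "\<dots> \<subseteq> line_sum X ?W"
    by (rule line_sum_mono) (simp_all add: absorb X Y S)
  also have "\<dots> = line_sum X (line_sum Y X)"
    using line_sum_comm[OF iX iY] by simp
  also have "\<dots> \<subseteq> line_sum Y X" by (rule absorb[OF Y X S(4,3)])
  also have "\<dots> = ?W" by (rule line_sum_comm[OF iY iX])
  finally show ?thesis
    unfolding subspace_iff using iW line_sum_line by blast
qed

section \<open>Spans and joins of consistent subspaces\<close>

definition span :: "'a set \<Rightarrow> 'a set" where
  "span A = \<Inter>{S. subspace P S \<and> A \<subseteq> S}"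

lemma span_minimal: "\<lbrakk>subspace P S; A \<subseteq> S\<rbrakk> \<Longrightarrow> span A \<subseteq> S"
  and span_superset: "A \<subseteq> span A"
  by (auto simp: span_def)

lemma subspace_span:
  assumes "A \<subseteq> carrier P"
  shows "subspace P (span A)"
proof -
  have "subspace P (carrier P)" by (auto simp: subspace_def)
  then have "span A \<subseteq> carrier P" using assms by (rule span_minimal)
  then show ?thesis
    unfolding subspace_def span_def by blast
qed

text \<open>IC2 gives downward closure and CC2 closure under lines. Spans can therefore not leave
  the set of points compatible with \<open>x\<close>.\<close>

lemma subspace_compatible:
  assumes x: "x \<in> carrier P"
  shows "subspace P {y \<in> carrier P. \<not> x \<smile> y}"
  unfolding subspace_def
proof (intro conjI ballI impI)
  fix y z assume "y \<in> {y \<in> carrier P. \<not> x \<smile> y}" "z \<in> carrier P" "z \<sqsubseteq> y"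
  then show "z \<in> {y \<in> carrier P. \<not> x \<smile> y}" using IC2[OF x _ x, of z y] x by auto
next
  fix p q r assume *: "p \<in> {y \<in> carrier P. \<not> x \<smile> y}" "q \<in> {y \<in> carrier P. \<not> x \<smile> y}" "r \<in> carrier P" "col p q r"
  then have "p \<noteq> q" using col_not_le[of p q r] by auto
  \<comment> \<open>Two distinct compatible points exclude the first alternative of CC2, which
    allows at most one.\<close>
  then have "card {p, q} = 2" by simp
  moreover have "card {p, q} \<le> card {s \<in> {p, q, r}. \<not> x \<smile> s}"
    using * by (intro card_mono) auto
  ultimately show "r \<in> {y \<in> carrier P. \<not> x \<smile> y}"
    using CC2[of p q r x] * x by auto
qed auto

text \<open>Two passes through \<open>subspace_compatible\<close>: first points of \<open>A\<close>
  against the span, then, by symmetry, points of the span against the span.\<close>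

lemma consistent_span:
  assumes A: "A \<subseteq> carrier P" "consistent P A"
  shows "consistent P (span A)"
proof -
  have 1: "\<not> x \<smile> y" if "x \<in> A" "y \<in> span A" for x y
    using span_minimal[OF subspace_compatible, of x A] that A by (auto simp: consistent_def)
  have spanC: "span A \<subseteq> carrier P" by (rule subspace_subset[OF subspace_span[OF A(1)]])
  have "\<not> x \<smile> y" if "x \<in> span A" "y \<in> span A" for x y
  proof -
    have "A \<subseteq> {z \<in> carrier P. \<not> y \<smile> z}"
      using 1 that A(1) incon_sym spanC by blast
    then have "span A \<subseteq> {z \<in> carrier P. \<not> y \<smile> z}"
      using that spanC by (intro span_minimal subspace_compatible) auto
    then show ?thesis using incon_sym that spanC by blast
  qed
  then show ?thesis by (auto simp: consistent_def)
qed

abbreviation CS :: "'a set gorder" where "CS \<equiv> consistent_subspaces P"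

lemma span_least:
  assumes "\<A> \<subseteq> carrier CS" "consistent P (\<Union>\<A>)"
  shows "least CS (span (\<Union>\<A>)) (Upper CS \<A>)"
proof (rule least_UpperI)
  have "X \<subseteq> carrier P" if "X \<in> \<A>" for X
    using subsetD[OF assms(1) that] subspace_subset by simp
  then have "\<Union>\<A> \<subseteq> carrier P" by blast
  then show "span (\<Union>\<A>) \<in> carrier CS"
    using assms(2) subspace_span consistent_span by simp
  show "X \<sqsubseteq>\<^bsub>CS\<^esub> span (\<Union>\<A>)" if "X \<in> \<A>" for X
    using span_superset[of "\<Union>\<A>"] Union_upper[OF that] by simp
  fix Y assume "Y \<in> Upper CS \<A>"
  then have Y: "subspace P Y" "\<And>X. X \<in> \<A> \<Longrightarrow> X \<subseteq> Y"
    using Upper_memD[of Y CS \<A>] assms(1) by (simp add: Upper_def, simp)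
  then have "\<Union>\<A> \<subseteq> Y" by blast
  with Y(1) show "span (\<Union>\<A>) \<sqsubseteq>\<^bsub>CS\<^esub> Y" using span_minimal by simp
qed (rule assms(1))

text \<open>Consistency concerns only pairs of points, so this criterion makes the triple join
  condition immediate.\<close>

lemma has_join_CS_iff:
  assumes "\<A> \<subseteq> carrier CS"
  shows "has_join CS \<A> \<longleftrightarrow> consistent P (\<Union>\<A>)"
proof
  assume "has_join CS \<A>"
  then obtain S where S: "least CS S (Upper CS \<A>)" by (auto simp: has_join_def)
  then have "\<Union>\<A> \<subseteq> S" using least_Upper_above[OF S] assms by fastforce
  moreover have "consistent P S" using least_closed[OF S] by simp
  ultimately show "consistent P (\<Union>\<A>)" by (rule consistent_mono[rotated])
next
  assume "consistent P (\<Union>\<A>)"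
  then show "has_join CS \<A>" using span_least[OF assms] by (auto simp: has_join_def)
qed

section \<open>Modularity of the semilattice of consistent subspaces\<close>

lemma subspace_Int: "\<lbrakk>subspace P X; subspace P Y\<rbrakk> \<Longrightarrow> subspace P (X \<inter> Y)"
  unfolding subspace_def by blast

text \<open>Inside \<open>S\<close> the join is \<open>line_sum\<close> and the meet is
  intersection, so the modular law becomes a claim about the points of one line.\<close>

lemma modular_lattice_principal_ideal_CS:
  assumes S: "S \<in> carrier CS"
  shows "modular_lattice (principal_ideal CS S)"
proof -
  let ?I = "principal_ideal CS S"
  have carrier: "X \<in> carrier ?I \<longleftrightarrow> subspace P X \<and> X \<subseteq> S" for X
    using S by (auto simp: principal_ideal_def intro: consistent_mono)
  have le: "X \<sqsubseteq>\<^bsub>?I\<^esub> Y \<longleftrightarrow> X \<subseteq> Y" and eq: "eq ?I = (=)" for X Y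
    by (simp_all add: principal_ideal_def)
  have po: "partial_order ?I"
    by unfold_locales (auto simp: le eq)
  interpret I: partial_order ?I by (rule po)
  have sub: "subspace P (line_sum X Y)" "line_sum X Y \<subseteq> S" if "X \<in> carrier ?I" "Y \<in> carrier ?I" for X Y
    using that S by (auto simp: carrier intro!: subspace_line_sum[of X Y S] dest: line_sum_subset[of S X Y])
  have lub: "least ?I (line_sum X Y) (Upper ?I {X, Y})" if "X \<in> carrier ?I" "Y \<in> carrier ?I" for X Y
  proof (rule least_UpperI)
    show "\<And>Z. Z \<in> {X, Y} \<Longrightarrow> Z \<sqsubseteq>\<^bsub>?I\<^esub> line_sum X Y"
      by (auto simp: le line_sum_def)
    fix Z assume "Z \<in> Upper ?I {X, Y}"
    then have "subspace P Z" "X \<subseteq> Z" "Y \<subseteq> Z" using that by (auto simp: Upper_def carrier le)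
    then show "line_sum X Y \<sqsubseteq>\<^bsub>?I\<^esub> Z" unfolding le by (rule line_sum_subset)
  qed (use that sub in \<open>auto simp: carrier\<close>)
  have glb: "greatest ?I (X \<inter> Y) (Lower ?I {X, Y})" if "X \<in> carrier ?I" "Y \<in> carrier ?I" for X Y
    by (rule greatest_LowerI) (use that in \<open>auto simp: carrier le Lower_def subspace_Int\<close>)
  interpret I: lattice ?I
    by unfold_locales (use lub glb in blast)+
  show ?thesis
  proof
    fix X Y Z assume XYZ: "X \<in> carrier ?I" "Y \<in> carrier ?I" "Z \<in> carrier ?I" "X \<sqsubseteq>\<^bsub>?I\<^esub> Z"
    have join: "A \<squnion>\<^bsub>?I\<^esub> B = line_sum A B" if "A \<in> carrier ?I" "B \<in> carrier ?I" for A B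
      unfolding join_def by (rule I.sup_eqI[OF lub[OF that]])
    have meet: "A \<sqinter>\<^bsub>?I\<^esub> B = A \<inter> B" if "A \<in> carrier ?I" "B \<in> carrier ?I" for A B
      using I.inf_of_two_greatest[OF that] glb[OF that] I.weak_greatest_unique
      unfolding meet_def I.eq_is_equal by blast
    have "line_sum X (Y \<inter> Z) = line_sum X Y \<inter> Z"
    proof
      show "line_sum X (Y \<inter> Z) \<subseteq> line_sum X Y \<inter> Z"
        using line_sum_mono[of X X "Y \<inter> Z" Y] line_sum_subset[of Z X "Y \<inter> Z"] XYZ
        by (auto simp: carrier le)
      show "line_sum X Y \<inter> Z \<subseteq> line_sum X (Y \<inter> Z)"
      proof
        fix z assume z: "z \<in> line_sum X Y \<inter> Z"
        have Z: "subspace P Z" "X \<subseteq> Z" and C: "X \<subseteq> carrier P" "Y \<subseteq> carrier P"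
          using XYZ by (auto simp: carrier le dest: subspace_subset)
        from z have "z \<in> line_sum X Y" by blast
        then show "z \<in> line_sum X (Y \<inter> Z)"
        proof (cases rule: line_sumE)
          case (3 x y)
          \<comment> \<open>A line is determined by any two of its points: \<open>x\<close> and
            \<open>z\<close> lie in \<open>Z\<close>, so the remaining point \<open>y\<close> does
            too.\<close>
          then have "col x z y"
            using col_swap[of z x y] col_rotate[of y z x] col_rotate[of x y z] C by blast
          then have "y \<in> Z" using subspace_line[OF Z(1), of x z y] 3 C Z(2) z by (meson IntD2 subsetD)
          then show ?thesis using 3 line_sum_line by blast
        qed (use z in \<open>auto simp: line_sum_def\<close>)
      qed
    qed
    moreover have "line_sum X Y \<in> carrier ?I" "Y \<inter> Z \<in> carrier ?I"
      using XYZ sub by (auto simp: carrier subspace_Int)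
    ultimately show "X \<squnion>\<^bsub>?I\<^esub> (Y \<sqinter>\<^bsub>?I\<^esub> Z) = (X \<squnion>\<^bsub>?I\<^esub> Y) \<sqinter>\<^bsub>?I\<^esub> Z"
      using XYZ join meet by simp
  qed
qed

lemma modular_semilattice_CS: "modular_semilattice CS"
proof -
  interpret C: partial_order CS by (rule partial_order_consistent_subspaces)
  have "lower_semilattice CS"
  proof
    fix X Y assume XY: "X \<in> carrier CS" "Y \<in> carrier CS"
    have "greatest CS (X \<inter> Y) (Lower CS {X, Y})"
      by (rule greatest_LowerI)
        (use XY in \<open>auto simp: Lower_def subspace_Int intro: consistent_mono\<close>)
    then show "\<exists>s. greatest CS s (Lower CS {X, Y})" by blast
  qed
  moreover have "modular_semilattice_axioms CS"
  proof (rule modular_semilattice_axioms.intro)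
    have "{} \<in> carrier CS" by (simp add: subspace_def consistent_def)
    then show "carrier CS \<noteq> {}" by blast
  next
    fix X Y Z
    assume XYZ: "X \<in> carrier CS" "Y \<in> carrier CS" "Z \<in> carrier CS"
      and "has_join CS {X, Y}" "has_join CS {Y, Z}" "has_join CS {Z, X}"
    then have "consistent P (X \<union> Y)" "consistent P (Y \<union> Z)" "consistent P (Z \<union> X)"
      by (simp_all add: has_join_CS_iff)
    then have "consistent P (\<Union>{X, Y, Z})"
      unfolding consistent_def by blast
    then show "has_join CS {X, Y, Z}" using XYZ by (simp add: has_join_CS_iff)
  qed (rule modular_lattice_principal_ideal_CS)
  ultimately show ?thesis by (rule modular_semilattice.intro)
qed

section \<open>Principal subspaces and their relations\<close>

definition down :: "'a \<Rightarrow> 'a set" where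
  "down p = {q \<in> carrier P. q \<sqsubseteq> p}"

lemma down_self: "p \<in> carrier P \<Longrightarrow> p \<in> down p"
  by (simp add: down_def)

lemma subspace_down:
  assumes p: "p \<in> carrier P"
  shows "subspace P (down p)"
  unfolding subspace_def down_def
proof (intro conjI ballI impI)
  fix x y assume "x \<in> {q \<in> carrier P. q \<sqsubseteq> p}" "y \<in> carrier P" "y \<sqsubseteq> x"
  then show "y \<in> {q \<in> carrier P. q \<sqsubseteq> p}" using le_trans[of y x p] p by simp
next
  fix x y z assume "x \<in> {q \<in> carrier P. q \<sqsubseteq> p}" "y \<in> {q \<in> carrier P. q \<sqsubseteq> p}" "z \<in> carrier P" "col x y z"
  then show "z \<in> {q \<in> carrier P. q \<sqsubseteq> p}" using CT2[of x y z p] p by simp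
qed auto

lemma down_subset_iff:
  assumes "subspace P X" "p \<in> carrier P"
  shows "down p \<subseteq> X \<longleftrightarrow> p \<in> X"
  using assms(2) down_self ideal_down[OF subspace_ideal[OF assms(1)], of p] unfolding down_def by blast

lemma down_le_iff:
  assumes "p \<in> carrier P" "q \<in> carrier P"
  shows "down p \<subseteq> down q \<longleftrightarrow> p \<sqsubseteq> q"
  using down_subset_iff[OF subspace_down[OF assms(2)] assms(1)] assms(1) by (simp add: down_def)

lemma down_in_CS:
  assumes p: "p \<in> carrier P"
  shows "down p \<in> carrier CS"
proof -
  have "\<not> x \<smile> y" if "x \<in> down p" "y \<in> down p" for x y
    using IC1[of x y] that p by (auto simp: down_def)
  then show ?thesis using subspace_down[OF p] by (auto simp: consistent_def)
qed

text \<open>The subset \<open>B\<close> is meant to be two points of a line and \<open>A\<close> the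
  whole line: all three pairs then get the same join \<open>span A\<close>.\<close>

lemma span_least_down:
  assumes A: "A \<subseteq> carrier P" "consistent P A" and B: "B \<subseteq> A" "A \<subseteq> span B"
  shows "least CS (span A) (Upper CS (down ` B))"
proof (rule least_UpperI)
  have BC: "B \<subseteq> carrier P" using A B by blast
  show "span A \<in> carrier CS" using subspace_span[OF A(1)] consistent_span[OF A] by simp
  show "down ` B \<subseteq> carrier CS" using down_in_CS BC by blast
  show "X \<sqsubseteq>\<^bsub>CS\<^esub> span A" if "X \<in> down ` B" for X
  proof -
    from that obtain b where "b \<in> B" "X = down b" by blast
    then show ?thesis
      using down_subset_iff[OF subspace_span[OF A(1)], of b] span_superset[of A] B(1) BC by auto
  qed
  fix Y assume "Y \<in> Upper CS (down ` B)"
  then have Y: "subspace P Y" "\<And>b. b \<in> B \<Longrightarrow> down b \<subseteq> Y"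
    using Upper_memD[of Y CS "down ` B"] \<open>down ` B \<subseteq> carrier CS\<close> by (simp add: Upper_def, simp)
  then have "B \<subseteq> Y" using down_subset_iff[OF Y(1)] BC by blast
  then have "span B \<subseteq> Y" by (rule span_minimal[OF Y(1)])
  then have "span A \<subseteq> Y" using B(2) by (intro span_minimal[OF Y(1)]) blast
  then show "span A \<sqsubseteq>\<^bsub>CS\<^esub> Y" by simp
qed

lemma has_join_down_iff:
  assumes "p \<in> carrier P" "q \<in> carrier P"
  shows "has_join CS {down p, down q} \<longleftrightarrow> \<not> p \<smile> q"
proof
  assume "has_join CS {down p, down q}"
  then have "consistent P (\<Union>{down p, down q})"
    using has_join_CS_iff[of "{down p, down q}"] down_in_CS assms by simp
  then show "\<not> p \<smile> q"
    using down_self assms unfolding consistent_def by blast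
next
  assume "\<not> p \<smile> q"
  then have "consistent P {p, q}"
    using assms incon_irrefl incon_sym[of q p] by (auto simp: consistent_def)
  then have "least CS (span {p, q}) (Upper CS (down ` {p, q}))"
    using assms by (intro span_least_down) (simp_all add: span_superset)
  then show "has_join CS {down p, down q}" by (auto simp: has_join_def)
qed

text \<open>Exchange property of a line sum of two principal subspaces, replacing modularity below:
  incomparability rules out that \<open>s\<close> is on a line through a point strictly below itself.\<close>

lemma line_sum_down_shrink:
  assumes "x \<in> carrier P" "s \<in> carrier P" "s' \<in> carrier P" "s' \<sqsubseteq> s"
    and s: "s \<in> line_sum (down x) (down s')"
  shows "s \<sqsubseteq> x \<or> s' = s"
  using s
proof (cases rule: line_sumE)
  case (3 u v)
  then have "v \<sqsubseteq> s" using le_trans[of v s' s] assms by (simp add: down_def)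
  then show ?thesis using col_not_le[of u v s] 3 by (simp add: down_def)
qed (use assms le_antisym in \<open>auto simp: down_def\<close>)

lemma subspace_line_sum_down:
  assumes S: "S \<in> carrier CS" "p \<in> S" "q \<in> S"
  shows "subspace P (line_sum (down p) (down q))"
    and "p \<in> line_sum (down p) (down q)" "q \<in> line_sum (down p) (down q)"
    and "line_sum (down p) (down q) \<subseteq> S"
proof -
  have C: "p \<in> carrier P" "q \<in> carrier P" using S subspace_subset[of S] by auto
  have D: "down p \<subseteq> S" "down q \<subseteq> S" using down_subset_iff[of S] C S by auto
  show "subspace P (line_sum (down p) (down q))"
    by (rule subspace_line_sum[OF subspace_down subspace_down _ _ D]) (use C S in auto)
  show "p \<in> line_sum (down p) (down q)" "q \<in> line_sum (down p) (down q)"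
    using down_self C line_sum_left line_sum_right by blast+
  show "line_sum (down p) (down q) \<subseteq> S" by (rule line_sum_subset[OF _ D]) (use S in simp)
qed

lemma span_col:
  assumes "p \<in> carrier P" "q \<in> carrier P" "r \<in> carrier P" "col p q r"
  shows "r \<in> span {p, q}"
proof (rule subspace_line)
  show "subspace P (span {p, q})" using assms by (intro subspace_span) simp
qed (use span_superset[of "{p, q}"] assms in auto)

text \<open>A line has the same span as any two of its points, which settles one direction.
  Conversely \<open>r\<close> lies on a line through some \<open>p'\<close> below \<open>p\<close>
  and \<open>q'\<close> below \<open>q\<close>, and exchange shows \<open>p' = p\<close> and
  \<open>q' = q\<close>.\<close>

lemma collinear_down_iff:
  assumes C: "p \<in> carrier P" "q \<in> carrier P" "r \<in> carrier P"
  shows "collinear (irreducible_pip CS) (down p) (down q) (down r) \<longleftrightarrow> col p q r"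
proof -
  interpret C: partial_order CS by (rule partial_order_consistent_subspaces)
  have inc: "incomparable CS (down x) (down y) \<longleftrightarrow> \<not> x \<sqsubseteq> y \<and> \<not> y \<sqsubseteq> x"
    if "x \<in> carrier P" "y \<in> carrier P" for x y
    using that by (simp add: incomparable_def down_le_iff)
  show ?thesis
  proof
    assume col: "col p q r"
    then have perm: "col q r p" "col r p q" using col_rotate C by blast+
    let ?S = "span {p, q, r}"
    note least = span_least_down[of "{p, q, r}", OF _ CC1[OF C col]]
    have "least CS ?S (Upper CS (down ` {p, q}))"
      by (rule least) (use C span_superset[of "{p, q}"] span_col[OF C col] in auto)
    moreover have "least CS ?S (Upper CS (down ` {q, r}))"
      by (rule least) (use C span_superset[of "{q, r}"] span_col[OF C(2,3,1) perm(1)] in auto)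
    moreover have "least CS ?S (Upper CS (down ` {r, p}))"
      by (rule least) (use C span_superset[of "{r, p}"] span_col[OF C(3,1,2) perm(2)] in auto)
    ultimately show "collinear (irreducible_pip CS) (down p) (down q) (down r)"
      using C col_not_le[OF C col] by (auto simp: C.collinear_irreducible_pip_iff inc)
  next
    assume "collinear (irreducible_pip CS) (down p) (down q) (down r)"
    then obtain S where inc': "\<not> p \<sqsubseteq> q" "\<not> q \<sqsubseteq> p" "\<not> q \<sqsubseteq> r" "\<not> r \<sqsubseteq> q" "\<not> p \<sqsubseteq> r" "\<not> r \<sqsubseteq> p"
      and S: "least CS S (Upper CS {down p, down q})" "least CS S (Upper CS {down q, down r})"
        "least CS S (Upper CS {down r, down p})"
      using C by (auto simp: C.collinear_irreducible_pip_iff inc)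
    have SC: "S \<in> carrier CS" by (rule least_closed[OF S(1)])
    have "down p \<subseteq> S" "down q \<subseteq> S" "down r \<subseteq> S"
      using least_Upper_above[OF S(1)] least_Upper_above[OF S(2)] C down_in_CS by auto
    then have mem: "p \<in> S" "q \<in> S" "r \<in> S" using down_self C by blast+
    have least: "S \<subseteq> T"
      if T: "subspace P T" "T \<subseteq> S" "x \<in> T" "y \<in> T" and xy: "x \<in> carrier P" "y \<in> carrier P"
        and lub: "least CS S (Upper CS {down x, down y})" for T x y
    proof -
      have "T \<in> carrier CS" using T SC consistent_mono by auto
      moreover have "down x \<subseteq> T" "down y \<subseteq> T" using down_subset_iff[OF T(1)] T xy by simp_all
      ultimately have "T \<in> Upper CS {down x, down y}" by (auto simp: Upper_def)
      then show ?thesis using least_le[OF lub] by simp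
    qed
    \<comment> \<open>The sum of \<open>down q\<close> and \<open>down p'\<close> contains
      \<open>q\<close> and \<open>r\<close>, hence is all of \<open>S\<close>. It therefore contains
      \<open>p\<close>, and \<open>line_sum_down_shrink\<close> applies.\<close>
    have shrink: "p' = p"
      if q: "q \<in> S" "q \<in> carrier P" and p: "p \<in> S" "p \<in> carrier P" "\<not> p \<sqsubseteq> q"
        and r: "r \<in> carrier P" and lub: "least CS S (Upper CS {down q, down r})"
        and p': "p' \<in> carrier P" "p' \<sqsubseteq> p" and q': "q' \<in> carrier P" "q' \<sqsubseteq> q" and col: "col p' q' r"
      for p q r p' q'
    proof -
      have "p' \<in> S"
        using ideal_down[OF subspace_ideal p(1) p'] SC by simp
      note T = subspace_line_sum_down[OF SC q(1) this]
      have "q' \<in> line_sum (down q) (down p')"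
        using q' by (intro line_sum_left) (simp add: down_def)
      then have "r \<in> line_sum (down q) (down p')"
        using subspace_line[OF T(1,3) _ r col] by blast
      then have "p \<in> line_sum (down q) (down p')"
        using least[OF T(1,4,2) _ q(2) r lub] p(1) by blast
      then show ?thesis using line_sum_down_shrink[OF q(2) p(2) p'] p(3) by blast
    qed
    note T = subspace_line_sum_down[OF SC mem(1,2)]
    have "r \<in> line_sum (down p) (down q)"
      using least[OF T(1,4,2,3) C(1,2) S(1)] mem(3) by blast
    then show "col p q r"
    proof (cases rule: line_sumE)
      case (3 p' q')
      then have p': "p' \<in> carrier P" "p' \<sqsubseteq> p" and q': "q' \<in> carrier P" "q' \<sqsubseteq> q" by (auto simp: down_def)
      have "p' = p"
        by (rule shrink[OF mem(2) C(2) mem(1) C(1) inc'(1) C(3) S(2) p' q' 3(4)])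
      moreover have "least CS S (Upper CS {down p, down r})"
        using S(3) by (simp add: insert_commute[of "down p" "down r"])
      then have "q' = q"
        by (rule shrink[OF mem(1) C(1) mem(2) C(2) inc'(2) C(3) _ q' p' col_swap[OF p'(1) q'(1) C(3) 3(4)]])
      ultimately show ?thesis using 3(4) by simp
    qed (use inc' in \<open>auto simp: down_def\<close>)
  qed
qed

text \<open>The points strictly below \<open>p\<close> form a subspace, since CT1 forbids a line
  through two of them to contain \<open>p\<close>. Two subspaces of \<open>down p\<close> that miss
  \<open>p\<close> are bounded by it.\<close>

lemma down_irreducible:
  assumes p: "p \<in> carrier P"
  shows "down p \<in> join_irreducibles CS"
  unfolding join_irreducibles_def
proof (intro CollectI conjI ballI impI)
  have "{} \<in> carrier CS" by (simp add: subspace_def consistent_def)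
  moreover have "\<not> down p \<subseteq> {}" using down_self[OF p] by blast
  ultimately show "\<not> least CS (down p) (carrier CS)" by (auto simp: least_def)
  fix X Y assume XY: "X \<in> carrier CS" "Y \<in> carrier CS" and lub: "least CS (down p) (Upper CS {X, Y})"
  have le: "X \<subseteq> down p" "Y \<subseteq> down p" using least_Upper_above[OF lub] XY by auto
  show "down p = X \<or> down p = Y"
  proof (rule ccontr)
    assume "\<not> (down p = X \<or> down p = Y)"
    then have notin: "p \<notin> X" "p \<notin> Y"
      using le down_subset_iff[OF _ p, of X] down_subset_iff[OF _ p, of Y] XY by auto
    let ?D = "{q \<in> down p. q \<noteq> p}"
    have "?D \<in> carrier CS"
    proof -
      have "subspace P ?D"
        unfolding subspace_iff ideal_def
      proof (intro conjI ballI impI)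
        fix x y assume "x \<in> ?D" "y \<in> carrier P" "y \<sqsubseteq> x"
        then show "y \<in> ?D" using le_trans[of y x p] le_antisym[of x p] p by (auto simp: down_def)
      next
        fix x y z assume *: "x \<in> ?D" "y \<in> ?D" "z \<in> carrier P" "col x y z"
        then have "z \<in> down p" using subspace_line[OF subspace_down[OF p]] by blast
        moreover have "z \<noteq> p" using col_not_le[of x y z] * by (auto simp: down_def)
        ultimately show "z \<in> ?D" by blast
      qed (auto simp: down_def)
      then show ?thesis using down_in_CS[OF p] consistent_mono[of "down p" ?D] by auto
    qed
    moreover have "X \<subseteq> ?D" "Y \<subseteq> ?D" using le notin by auto
    ultimately have "?D \<in> Upper CS {X, Y}" by (auto simp: Upper_def)
    then have "down p \<subseteq> ?D" using least_le[OF lub] by simp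
    then show False using down_self[OF p] by blast
  qed
qed (rule down_in_CS[OF p])

text \<open>\<open>lev n p\<close> says that \<open>p\<close> has height at least \<open>n\<close>.\<close>

primrec lev :: "nat \<Rightarrow> 'a \<Rightarrow> bool" where
  "lev 0 p \<longleftrightarrow> p \<in> carrier P"
| "lev (Suc n) p \<longleftrightarrow> p \<in> carrier P \<and> (\<exists>q. lev n q \<and> q \<sqsubseteq> p \<and> q \<noteq> p)"

section \<open>Heights of points and collinearity\<close>

lemma lev_closed: "lev n p \<Longrightarrow> p \<in> carrier P"
  by (cases n) simp_all

lemma lev_mono:
  assumes "lev n p" "q \<in> carrier P" "p \<sqsubseteq> q"
  shows "lev n q"
proof (cases n)
  case (Suc m)
  then obtain x where "lev m x" "x \<sqsubseteq> p" "x \<noteq> p" using assms by auto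
  then show ?thesis
    using Suc assms lev_closed[of n p] lev_closed[of m x] le_trans[of x p q] le_antisym[of p x] by auto
qed (use assms in simp)

lemma lev_chain:
  assumes "lev n p"
  obtains K where "is_chain P K" "finite K" "card K = Suc n" "\<And>x. x \<in> K \<Longrightarrow> x \<sqsubseteq> p"
  using assms
proof (induction n arbitrary: p thesis)
  case 0
  then show ?case by (intro 0(1)[of "{p}"]) (auto simp: is_chain_def)
next
  case (Suc n)
  then obtain q where q: "p \<in> carrier P" "lev n q" "q \<sqsubseteq> p" "q \<noteq> p" by auto
  obtain K where K: "is_chain P K" "finite K" "card K = Suc n" "\<And>x. x \<in> K \<Longrightarrow> x \<sqsubseteq> q"
    using Suc.IH[OF _ q(2)] by blast
  have cl: "q \<in> carrier P" "K \<subseteq> carrier P" using lev_closed[OF q(2)] K(1) by (auto simp: is_chain_def)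
  have le: "x \<sqsubseteq> p" if "x \<in> K" for x using le_trans[OF K(4)[OF that] q(3)] that cl q(1) by blast
  have "p \<notin> K" using K(4) le_antisym q cl by blast
  then show ?case
    using K le q cl by (intro Suc.prems(1)[of "insert p K"]) (auto simp: is_chain_def)
qed

lemma lev_bounded:
  assumes "finite_length P"
  obtains n where "\<And>p. \<not> lev n p"
proof -
  obtain n where n: "\<And>K. is_chain P K \<Longrightarrow> card K \<le> n"
    using assms by (auto simp: finite_length_def)
  have "\<not> lev n p" for p
  proof
    assume "lev n p"
    then obtain K where "is_chain P K" "card K = Suc n" by (rule lev_chain)
    then show False using n by force
  qed
  then show thesis by (rule that)
qed

text \<open>If \<open>q' = q\<close>, then \<open>q\<close>, and with it \<open>s\<close>, lies in
  the sum of \<open>down r\<close> and \<open>down s'\<close>; exchange then gives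
  \<open>s' = s\<close>. So Regularity at a strictly smaller point moves strictly down, as the
  induction on heights requires.\<close>

lemma col_regularity_strict:
  assumes C: "q \<in> carrier P" "r \<in> carrier P" "s \<in> carrier P" and col: "col q r s"
    and s': "s' \<in> carrier P" "s' \<sqsubseteq> s" "s' \<noteq> s"
    and q': "q' \<in> carrier P" "q' \<sqsubseteq> q" and r': "r' \<in> carrier P" "r' \<sqsubseteq> r" and col': "col q' r' s'"
  shows "q' \<noteq> q"
proof
  assume eq: "q' = q"
  let ?S = "span {q, r, s}"
  have S: "?S \<in> carrier CS"
    using subspace_span[of "{q, r, s}"] consistent_span[of "{q, r, s}"] CC1[OF C col] C by simp
  have mem: "r \<in> ?S" "s \<in> ?S" using span_superset[of "{q, r, s}"] by auto
  then have "s' \<in> ?S" using ideal_down[OF subspace_ideal mem(2) s'(1,2)] S by simp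
  note T = subspace_line_sum_down[OF S mem(1) this]
  have "r' \<in> line_sum (down r) (down s')"
    using ideal_down[OF subspace_ideal[OF T(1)] T(2) r'] .
  moreover have "col r' s' q"
    using col_rotate[OF C(1) r'(1) s'(1)] col' eq by blast
  ultimately have "q \<in> line_sum (down r) (down s')"
    using subspace_line[OF T(1) _ T(3) C(1)] by blast
  then have "s \<in> line_sum (down r) (down s')"
    using subspace_line[OF T(1) _ T(2) C(3) col] by blast
  then show False
    using line_sum_down_shrink[OF C(2,3) s'(1,2)] s'(3) col_not_le[OF C col] by blast
qed

text \<open>By induction on the height: Regularity carries a point strictly below \<open>s\<close>
  to points strictly below \<open>q\<close> and \<open>r\<close>. It follows that the points of
  height less than \<open>n\<close> are closed under lines.\<close>

lemma lev_col:
  assumes "lev n s" "col q r s" "q \<in> carrier P" "r \<in> carrier P"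
  shows "lev n q \<or> lev n r"
  using assms
proof (induction n arbitrary: q r s)
  case 0
  then show ?case by simp
next
  case (Suc n)
  note C = Suc.prems(3,4) lev_closed[OF Suc.prems(1)] and col = Suc.prems(2)
  obtain s' where s': "lev n s'" "s' \<sqsubseteq> s" "s' \<noteq> s" using Suc.prems(1) by auto
  have s'C: "s' \<in> carrier P" by (rule lev_closed[OF s'(1)])
  note inc = col_not_le[OF C col]
  show ?case
  proof (cases "s' \<sqsubseteq> q \<or> s' \<sqsubseteq> r")
    case True
    moreover have "s' \<noteq> q" "s' \<noteq> r" using s'(2) inc by auto
    ultimately show ?thesis using s'(1) C by auto
  next
    case False
    then obtain q' r' where q': "q' \<in> carrier P" "q' \<sqsubseteq> q" and r': "r' \<in> carrier P" "r' \<sqsubseteq> r"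
      and col': "col q' r' s'"
      using regularity[OF C s'C col s'(2)] by blast
    have "q' \<noteq> q" by (rule col_regularity_strict[OF C col s'C s'(2,3) q' r' col'])
    moreover have "r' \<noteq> r"
      by (rule col_regularity_strict[OF C(2,1,3) col_swap[OF C col] s'C s'(2,3) r' q'
          col_swap[OF q'(1) r'(1) s'C col']])
    moreover have "lev n q' \<or> lev n r'" using Suc.IH[OF s'(1) col' q'(1) r'(1)] .
    ultimately show ?thesis using C q' r' by auto
  qed
qed

section \<open>Irreducible subspaces are principal\<close>

lemma subspace_Union_chain:
  assumes "\<C> \<noteq> {}" "\<And>X. X \<in> \<C> \<Longrightarrow> subspace P X" "\<And>X Y. X \<in> \<C> \<Longrightarrow> Y \<in> \<C> \<Longrightarrow> X \<subseteq> Y \<or> Y \<subseteq> X"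
  shows "subspace P (\<Union>\<C>)"
  unfolding subspace_iff ideal_def
proof (intro conjI ballI impI)
  show "\<Union>\<C> \<subseteq> carrier P" using assms(2) subspace_subset by blast
next
  fix x y assume "x \<in> \<Union>\<C>" "y \<in> carrier P" "y \<sqsubseteq> x"
  then show "y \<in> \<Union>\<C>" using assms(2) ideal_down subspace_ideal by blast
next
  fix x y z assume *: "x \<in> \<Union>\<C>" "y \<in> \<Union>\<C>" "z \<in> carrier P" "col x y z"
  then obtain X where "X \<in> \<C>" "x \<in> X" "y \<in> X" using assms(3) by blast
  then show "z \<in> \<Union>\<C>" using subspace_line[OF assms(2) _ _ *(3,4)] by blast
qed

text \<open>Subspaces of \<open>X\<close> need not satisfy any chain condition.  The complement of \<open>down p\<close> used here
  is maximal among those that avoid \<open>p\<close> and contain every point of less than maximal height; without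
  the latter condition it need not span \<open>X\<close> together with \<open>p\<close>.\<close>

lemma irreducible_principal:
  assumes fin: "finite_length P" and X: "X \<in> join_irreducibles CS"
  obtains p where "p \<in> carrier P" "X = down p"
proof -
  have XC: "X \<in> carrier CS" by (rule join_irreducibles_closed[OF X])
  then have XS: "subspace P X" and Xcon: "consistent P X" by simp_all
  have Xsub: "X \<subseteq> carrier P" by (rule subspace_subset[OF XS])
  have "X \<noteq> {}"
    using X XC by (auto simp: join_irreducibles_def least_def)
  \<comment> \<open>\<open>N\<close> is the first height not reached in \<open>X\<close>. It is
    positive because \<open>X\<close> is nonempty, so its predecessor \<open>m\<close> is the
    maximal height, attained at \<open>p\<close>.\<close>
  define N where "N = (LEAST n. \<forall>p\<in>X. \<not> lev n p)"
  obtain n where "\<And>p. \<not> lev n p" using lev_bounded[OF fin] by blast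
  then have "\<forall>p\<in>X. \<not> lev n p" by blast
  then have top: "\<forall>p\<in>X. \<not> lev N p" unfolding N_def by (rule LeastI)
  then have "N \<noteq> 0" using \<open>X \<noteq> {}\<close> Xsub by (metis all_not_in_conv lev.simps(1) subsetD)
  then obtain m where m: "N = Suc m" using not0_implies_Suc by blast
  then have "\<not> (\<forall>p\<in>X. \<not> lev m p)" using not_less_Least[of m "\<lambda>n. \<forall>p\<in>X. \<not> lev n p"] N_def by simp
  then obtain p where p: "p \<in> X" "lev m p" by blast
  have pC: "p \<in> carrier P" using p Xsub by blast
  define W where "W = {q \<in> X. \<not> lev m q}"
  have W: "subspace P W"
    unfolding subspace_iff ideal_def
  proof (intro conjI ballI impI)
    show "W \<subseteq> carrier P" using Xsub by (auto simp: W_def)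
    fix x y assume "x \<in> W" "y \<in> carrier P" "y \<sqsubseteq> x"
    then show "y \<in> W"
      using ideal_down[OF subspace_ideal[OF XS]] lev_mono[of m y x] Xsub by (auto simp: W_def)
  next
    fix x y z assume "x \<in> W" "y \<in> W" "z \<in> carrier P" "col x y z"
    then show "z \<in> W"
      using subspace_line[OF XS] lev_col[of m z x y] Xsub unfolding W_def by blast
  qed
  \<comment> \<open>A point strictly below some \<open>q\<close> in \<open>X\<close> has less than
    maximal height: otherwise \<open>q\<close> would reach height \<open>Suc m\<close>.\<close>
  have below: "q' \<in> W" if "q \<in> X" "q' \<in> carrier P" "q' \<sqsubseteq> q" "q' \<noteq> q" for q q'
    using that top m ideal_down[OF subspace_ideal[OF XS] that(1-3)] Xsub unfolding W_def by auto
  let ?F = "{Y. subspace P Y \<and> W \<subseteq> Y \<and> Y \<subseteq> X \<and> p \<notin> Y}"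
  have "\<exists>Y\<in>?F. \<forall>Z\<in>?F. Y \<subseteq> Z \<longrightarrow> Z = Y"
  proof (rule subset_Zorn_nonempty)
    have "W \<in> ?F" using W p by (auto simp: W_def)
    then show "?F \<noteq> {}" by blast
    fix \<C> assume \<C>: "\<C> \<noteq> {}" "subset.chain ?F \<C>"
    then have sub: "\<C> \<subseteq> ?F" and chain: "\<And>Y Z. Y \<in> \<C> \<Longrightarrow> Z \<in> \<C> \<Longrightarrow> Y \<subseteq> Z \<or> Z \<subseteq> Y"
      by (auto simp: subset_chain_def)
    have "subspace P (\<Union>\<C>)"
      using sub by (intro subspace_Union_chain[OF \<C>(1) _ chain]) auto
    then show "\<Union>\<C> \<in> ?F" using sub \<C>(1) by blast
  qed
  then obtain Y where YF: "Y \<in> ?F" and maxF: "\<forall>Z\<in>?F. Y \<subseteq> Z \<longrightarrow> Z = Y" by (elim bexE)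
  from YF have Y: "subspace P Y" "W \<subseteq> Y" "Y \<subseteq> X" "p \<notin> Y" by simp_all
  have max: "Z = Y" if "subspace P Z" "Z \<subseteq> X" "p \<notin> Z" "Y \<subseteq> Z" for Z
    using maxF that Y(2) by simp
  have YC: "Y \<subseteq> carrier P" by (rule subspace_subset[OF Y(1)])
  have downX: "down q \<subseteq> X" if "q \<in> X" for q
    using down_subset_iff[OF XS] that Xsub by blast
  let ?Z = "line_sum Y (down p)"
  have X_le: "X \<subseteq> ?Z"
  proof
    fix q assume q: "q \<in> X"
    have qC: "q \<in> carrier P" using q Xsub by blast
    show "q \<in> ?Z"
    proof (cases "q \<in> Y \<or> q = p")
      case True
      then show ?thesis using line_sum_left line_sum_right down_self[OF pC] by blast
    next
      case False
      let ?V = "line_sum Y (down q)"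
      have V: "subspace P ?V" "?V \<subseteq> X"
        using subspace_line_sum[OF Y(1) subspace_down[OF qC] XS Xcon Y(3) downX[OF q]]
          line_sum_subset[OF XS Y(3) downX[OF q]] by blast+
      have "Y \<subseteq> ?V" "q \<in> ?V" using line_sum_left line_sum_right down_self[OF qC] by blast+
      \<comment> \<open>Adding \<open>q\<close> strictly enlarges \<open>Y\<close> within
        \<open>X\<close>, so by maximality the larger subspace cannot avoid
        \<open>p\<close>.\<close>
      then have "p \<in> ?V" using max[OF V] False by blast
      then show ?thesis
      proof (cases rule: line_sumE)
        case 1
        then show ?thesis using Y by blast
      next
        case 2
        then have "p \<in> W" using below[OF q pC] False by (auto simp: down_def)
        then show ?thesis using Y by blast
      next
        case (3 y q')
        have y: "y \<in> carrier P" using 3 YC by blast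
        have q': "q' \<in> carrier P" "q' \<sqsubseteq> q" using 3 by (auto simp: down_def)
        \<comment> \<open>A strictly smaller \<open>q'\<close> would lie in \<open>W\<close>, hence
          in \<open>Y\<close>, and the line through \<open>y\<close> and \<open>q'\<close> would
          bring \<open>p\<close> into \<open>Y\<close>. With \<open>q' = q\<close> the line can be
          read as joining \<open>y\<close> and \<open>p\<close> to \<open>q\<close>.\<close>
        have "q' = q"
        proof (rule ccontr)
          assume "q' \<noteq> q"
          then have "q' \<in> Y" using below[OF q q'] Y(2) by blast
          then show False using subspace_line[OF Y(1) 3(2) _ pC 3(4)] Y(4) by blast
        qed
        then have "col y p q"
          using 3(4) col_swap[OF qC y pC] col_rotate[OF y qC pC]
            col_rotate[OF pC y qC] col_swap[OF pC y qC] col_rotate[OF qC pC y] by blast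
        then show ?thesis by (rule line_sum_line[OF 3(2) down_self[OF pC] qC])
      qed
    qed
  qed
  have "least CS X (Upper CS {Y, down p})"
  proof (rule least_UpperI)
    show "{Y, down p} \<subseteq> carrier CS"
      using Y(1,3) Xcon consistent_mono down_in_CS[OF pC] by auto
    show "\<And>Z. Z \<in> {Y, down p} \<Longrightarrow> Z \<sqsubseteq>\<^bsub>CS\<^esub> X" using Y(3) downX[OF p(1)] by auto
    fix Z assume "Z \<in> Upper CS {Y, down p}"
    then have "subspace P Z" "Y \<subseteq> Z" "down p \<subseteq> Z"
      using \<open>{Y, down p} \<subseteq> carrier CS\<close> by (auto simp: Upper_def)
    then have "?Z \<subseteq> Z" by (rule line_sum_subset)
    then show "X \<sqsubseteq>\<^bsub>CS\<^esub> Z" using X_le by simp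
  qed (rule XC)
  moreover have "Y \<in> carrier CS" using Y(1,3) Xcon consistent_mono by auto
  ultimately have "X = Y \<or> X = down p"
    using X down_in_CS[OF pC] unfolding join_irreducibles_def by blast
  then have "X = down p" using Y(4) p(1) by blast
  then show thesis using that pC by blast
qed

section \<open>The isomorphism with the irreducible consistent subspaces\<close>

lemma pip_iso_down:
  assumes "finite_length P"
  shows "pip_iso P (irreducible_pip CS) down"
proof -
  interpret C: partial_order CS by (rule partial_order_consistent_subspaces)
  have "weak_partial_order (irreducible_pip CS)"
  proof -
    have "partial_order (irreducible_pip CS)"
      by unfold_locales (auto simp: irreducible_pip_def)
    then show ?thesis by (rule partial_order.axioms)
  qed
  then have "order_emb P (irreducible_pip CS) down"
    using weak_partial_order_axioms by (simp add: order_emb_def down_le_iff)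
  moreover have "inj_on down (carrier P)"
    using down_le_iff le_antisym by (metis inj_onI subset_refl)
  moreover have "down ` carrier P = join_irreducibles CS"
    using down_irreducible irreducible_principal[OF assms] by blast
  ultimately show ?thesis
    unfolding pip_iso_def order_iso_def bij_betw_def
    by (simp add: has_join_down_iff collinear_down_iff)
qed

end

text \<open>\<open>down\<close> maps \<open>P\<close> to the irreducible subspaces, whereas the
  final statement asks for a map in the opposite direction.\<close>

lemma pip_iso_inverse:
  assumes "pip_iso P Q f"
  shows "pip_iso Q P (the_inv_into (carrier P) f)"
proof -
  let ?g = "the_inv_into (carrier P) f"
  have bij: "bij_betw f (carrier P) (carrier Q)"
    using assms by (simp add: pip_iso_def order_iso_def)
  have g: "?g q \<in> carrier P" "f (?g q) = q" if "q \<in> carrier Q" for q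
    using bij that f_the_inv_into_f_bij_betw[OF bij]
      bij_betw_apply[OF bij_betw_the_inv_into[OF bij]] by auto
  have emb: "weak_partial_order P" "weak_partial_order Q"
    and le: "\<And>x y. \<lbrakk>x \<in> carrier P; y \<in> carrier P\<rbrakk> \<Longrightarrow> f x \<sqsubseteq>\<^bsub>Q\<^esub> f y \<longleftrightarrow> x \<sqsubseteq>\<^bsub>P\<^esub> y"
    and incon: "\<And>x y. \<lbrakk>x \<in> carrier P; y \<in> carrier P\<rbrakk> \<Longrightarrow> f x \<smile>\<^bsub>Q\<^esub> f y \<longleftrightarrow> x \<smile>\<^bsub>P\<^esub> y"
    and col: "\<And>x y z. \<lbrakk>x \<in> carrier P; y \<in> carrier P; z \<in> carrier P\<rbrakk>
      \<Longrightarrow> col\<^bsub>Q\<^esub> (f x) (f y) (f z) \<longleftrightarrow> col\<^bsub>P\<^esub> x y z"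
    using assms by (simp_all add: pip_iso_def order_iso_def order_emb_def)
  show ?thesis
    unfolding pip_iso_def order_iso_def order_emb_def
  proof (intro conjI ballI)
    show "bij_betw ?g (carrier Q) (carrier P)" by (rule bij_betw_the_inv_into[OF bij])
    fix x y assume xy: "x \<in> carrier Q" "y \<in> carrier Q"
    show "?g x \<sqsubseteq>\<^bsub>P\<^esub> ?g y \<longleftrightarrow> x \<sqsubseteq>\<^bsub>Q\<^esub> y"
      using le[of "?g x" "?g y"] g xy by simp
    show "x \<smile>\<^bsub>Q\<^esub> y \<longleftrightarrow> ?g x \<smile>\<^bsub>P\<^esub> ?g y"
      using incon[of "?g x" "?g y"] g xy by simp
    fix z assume "z \<in> carrier Q"
    then show "col\<^bsub>Q\<^esub> x y z \<longleftrightarrow> col\<^bsub>P\<^esub> (?g x) (?g y) (?g z)"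
      using col[of "?g x" "?g y" "?g z"] g xy by simp
  qed (rule emb)+
qed

theorem theorem2p6:
  fixes L :: "('a, 'm) gorder_scheme" and P :: "('b, 'n) pip_scheme"
  shows
    "(modular_semilattice L \<and> finite_length L \<longrightarrow>
        PPIP (irreducible_pip L) \<and> finite_length (irreducible_pip L) \<and>
        order_iso L (consistent_subspaces (irreducible_pip L)) (phi L) \<and>
        least L (psi L {}) (carrier L) \<and>
        (\<forall>I\<in>carrier (consistent_subspaces (irreducible_pip L)).
           I \<noteq> {} \<longrightarrow> least L (psi L I) (Upper L I)) \<and>
        (\<forall>l\<in>carrier L. psi L (phi L l) = l) \<and>
        (\<forall>I\<in>carrier (consistent_subspaces (irreducible_pip L)).
           psi L I \<in> carrier L \<and> phi L (psi L I) = I))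
     \<and>
     (PPIP P \<and> finite_length P \<longrightarrow>
        modular_semilattice (consistent_subspaces P) \<and>
        (\<exists>f. pip_iso (irreducible_pip (consistent_subspaces P)) P f))"
proof (intro conjI impI; elim conjE)
  assume "modular_semilattice L" "finite_length L"
  then interpret finite_length_modular_semilattice L
    by (simp add: finite_length_modular_semilattice_def finite_length_modular_semilattice_axioms_def)
  show "PPIP (irreducible_pip L)" by (rule PPIP_irreducible_pip)
  show "finite_length (irreducible_pip L)" by (rule finite_length_irreducible_pip)
  show "order_iso L (consistent_subspaces (irreducible_pip L)) (phi L)" by (rule order_iso_phi)
  obtain b where "least L b (carrier L)" by (rule bottom_exists)
  \<comment> \<open>The minimum is the least upper bound of the empty set, so \<open>psi_eqI\<close>
    also covers the default value of \<open>psi\<close>.\<close>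
  then show "least L (psi L {}) (carrier L)" using psi_eqI[of b "{}"] by simp
  show "\<forall>I\<in>carrier (consistent_subspaces (irreducible_pip L)).
      I \<noteq> {} \<longrightarrow> least L (psi L I) (Upper L I)"
    using psi_consistent_subspace(1) by blast
  show "\<forall>l\<in>carrier L. psi L (phi L l) = l" using psi_phi by blast
  show "\<forall>I\<in>carrier (consistent_subspaces (irreducible_pip L)).
      psi L I \<in> carrier L \<and> phi L (psi L I) = I"
    using psi_consistent_subspace least_closed by blast
next
  assume "PPIP P" "finite_length P"
  then interpret PPIP P by blast
  show "modular_semilattice (consistent_subspaces P)" by (rule modular_semilattice_CS)
  show "\<exists>f. pip_iso (irreducible_pip (consistent_subspaces P)) P f"
    using pip_iso_inverse[OF pip_iso_down[OF \<open>finite_length P\<close>]] by blast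
qed

end
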